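(* Let $G$ be a countable directed graph with no sinks. Let $T=(T_e)_{e\in E(G)}$ be a row contraction on a Hilbert space $\mathcal{H}$ which is stabilized by a family of projections $\{P'_x:x\in V(G)\}$ on $\mathcal{H}$ (with associated directed graph $G$), and suppose that $$\lim_{d\to\infty}\Big(\sum_{w\in\mathbb{F}^+(G)_d}\|w(T)^*\xi\|\Big)=0\qquad\text{for all }\xi\in\mathcal{H}.$$ Then there is a contractive homomorphism $$\Psi:\mathfrak{L}_G\longrightarrow B(\mathcal{H})$$ defined by $\Psi(L_e)=T_e$ and $\Psi(P_x)=P'_x$ for $e\in E(G)$ and $x\in V(G)$.
   Context: $G$ is a countable directed graph with edge set $E(G)$ and vertex set $V(G)$; $s(e)$, $r(e)$ denote the source and range vertices of an edge $e$. $G$ has no sinks if every vertex is the source of some edge. The free semigroupoid $\mathbb{F}^+(G)$ is the set of all vertices and all finite paths $w=e_k\cdots e_1$ of $G$ (with $s(e_{i+1})=r(e_i)$, $s(w)=s(e_1)$, $r(w)=r(e_k)$, and $s(x)=r(x)=x$ for vertices), with concatenation; $\mathbb{F}^+(G)_d$ is the set of paths of length $d$. For $w=e_k\cdots e_1$, $w(T)=T_{e_k}\cdots T_{e_1}$. Row contraction: $T=(T_e)_{e\in E(G)}$ is a family of non-zero bounded operators on $\mathcal{H}$ with $\sum_{e}T_eT_e^*\le I$. Stabilization: $\{P'_x:x\in V(G)\}$ is a family of mutually orthogonal projections on $\mathcal{H}$ which sum to the identity and satisfy $T_eP'_x,\ P'_xT_e\in\{T_e,0\}$ for all $e\in E(G)$,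 $x\in V(G)$; the associated graph is $G$, meaning $P'_{r(e)}T_eP'_{s(e)}=T_e$ for all $e\in E(G)$. $\mathcal{H}_G$ is the Hilbert space with orthonormal basis $\{\xi_w : w\in\mathbb{F}^+(G)\}$; $L_e\xi_w=\xi_{ew}$ if $r(w)=s(e)$ and $0$ otherwise; $P_x$ is the projection of $\mathcal{H}_G$ onto $\overline{\mathrm{span}}\{\xi_w:r(w)=x\}$. The free semigroupoid algebra $\mathfrak{L}_G$ is the weak-operator-topology closed algebra generated by $\{L_e,P_x: e\in E(G),x\in V(G)\}$. *)

theory Defs
  imports "HOL-Analysis.Analysis" "Graph_Theory.Arc_Walk"
begin

section \<open>Complex Hilbert spaces\<close>

text \<open>
  A complex Hilbert space is a real one (for the real part of the inner product) with a
  compatible complex structure; norm, metric and infinite sums are those of the real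
  structure.  The inner product is linear in the first argument.
\<close>

class chilbert_space = real_inner + banach +
  fixes scaleC :: "complex \<Rightarrow> 'a \<Rightarrow> 'a" (infixr "*\<^sub>C" 75)
    and cinner :: "'a \<Rightarrow> 'a \<Rightarrow> complex"
  assumes scaleC_add_right: "c *\<^sub>C (x + y) = c *\<^sub>C x + c *\<^sub>C y"
    and scaleC_add_left: "(c + d) *\<^sub>C x = c *\<^sub>C x + d *\<^sub>C x"
    and scaleC_scaleC: "c *\<^sub>C (d *\<^sub>C x) = (c * d) *\<^sub>C x"
    and scaleC_of_real: "complex_of_real t *\<^sub>C x = t *\<^sub>R x"
    and cinner_commute: "cinner x y = cnj (cinner y x)"
    and cinner_add_left: "cinner (x + y) z = cinner x z + cinner y z"
    and cinner_scaleC_left: "cinner (c *\<^sub>C x) y = c * cinner x y"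
    and Re_cinner: "Re (cinner x y) = inner x y"

lemma cinner_self: "cinner x x = complex_of_real ((norm x)\<^sup>2)"
  for x :: "'a::chilbert_space"
proof (rule complex_eqI)
  show "Re (cinner x x) = Re (complex_of_real ((norm x)\<^sup>2))"
    by (simp add: Re_cinner power2_norm_eq_inner)
  have "cinner x x = cnj (cinner x x)" by (rule cinner_commute)
  then have "Im (cinner x x) = Im (cnj (cinner x x))" by metis
  then show "Im (cinner x x) = Im (complex_of_real ((norm x)\<^sup>2))" by simp
qed

lemma norm_scaleC: "norm (c *\<^sub>C x) = cmod c * norm x"
  for x :: "'a::chilbert_space"
proof -
  have "cinner (c *\<^sub>C x) (c *\<^sub>C x) = c * cnj (c * cinner x x)"
    by (metis cinner_commute cinner_scaleC_left)
  also have "\<dots> = (c * cnj c) * cinner x x"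
    by (simp add: cinner_self)
  also have "\<dots> = complex_of_real ((cmod c * norm x)\<^sup>2)"
    by (simp only: complex_norm_square[symmetric] cinner_self of_real_mult[symmetric] power_mult_distrib)
  finally have "(norm (c *\<^sub>C x))\<^sup>2 = (cmod c * norm x)\<^sup>2"
    by (simp only: cinner_self of_real_eq_iff)
  then show ?thesis by simp
qed

global_interpretation complex_vector: vector_space "scaleC :: complex \<Rightarrow> 'a \<Rightarrow> 'a::chilbert_space"
  defines cspan = complex_vector.span
proof
  show "1 *\<^sub>C x = x" for x :: 'a
    using scaleC_of_real[of 1 x] by simp
qed (simp_all add: scaleC_add_right scaleC_add_left scaleC_scaleC)


section \<open>Bounded operators\<close>

text \<open>The library's type of bounded operators consists of the real-linear ones.\<close>

definition cbounded :: "('a::chilbert_space \<Rightarrow>\<^sub>L 'a) set" where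
  "cbounded = {A. \<forall>c x. blinfun_apply A (c *\<^sub>C x) = c *\<^sub>C blinfun_apply A x}"

lift_definition scaleC_op ::
  "complex \<Rightarrow> ('a::chilbert_space \<Rightarrow>\<^sub>L 'a) \<Rightarrow> ('a \<Rightarrow>\<^sub>L 'a)" is "\<lambda>c A x. c *\<^sub>C A x"
proof -
  fix c :: complex and A :: "'a \<Rightarrow> 'a"
  assume "bounded_linear A"
  moreover have "bounded_linear (\<lambda>x :: 'a. c *\<^sub>C x)"
  proof (rule bounded_linear_intro[where K = "cmod c"])
    show "c *\<^sub>C (t *\<^sub>R x) = t *\<^sub>R (c *\<^sub>C x)" for t and x :: 'a
      by (simp add: scaleC_of_real[symmetric] scaleC_scaleC mult.commute)
  qed (simp_all add: scaleC_add_right norm_scaleC mult.commute)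
  ultimately show "bounded_linear (\<lambda>x. c *\<^sub>C A x)"
    by (rule bounded_linear_compose[rotated])
qed

definition cadjoint :: "('a::chilbert_space \<Rightarrow>\<^sub>L 'a) \<Rightarrow> ('a \<Rightarrow>\<^sub>L 'a)" where
  "cadjoint A = (THE B. B \<in> cbounded \<and> (\<forall>x y. cinner (A x) y = cinner x (B y)))"

definition positive_op :: "('a::chilbert_space \<Rightarrow>\<^sub>L 'a) \<Rightarrow> bool" where
  "positive_op A \<longleftrightarrow> A \<in> cbounded \<and> (\<forall>x. cinner (A x) x \<in> \<real>\<^sub>\<ge>\<^sub>0)"

definition op_le :: "('a::chilbert_space \<Rightarrow>\<^sub>L 'a) \<Rightarrow> ('a \<Rightarrow>\<^sub>L 'a) \<Rightarrow> bool" where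
  "op_le A B \<longleftrightarrow> positive_op (B - A)"

definition is_projection :: "('a::chilbert_space \<Rightarrow>\<^sub>L 'a) \<Rightarrow> bool" where
  "is_projection P \<longleftrightarrow> P \<in> cbounded \<and> P o\<^sub>L P = P \<and> cadjoint P = P"

definition projection_onto :: "'a::chilbert_space set \<Rightarrow> ('a \<Rightarrow>\<^sub>L 'a)" where
  "projection_onto M = (THE P. is_projection P \<and> range (blinfun_apply P) = M)"

text \<open>The coarsest topology making all functionals \<open>A \<mapsto> \<langle>A x, y\<rangle>\<close> continuous.\<close>

definition weak_operator_topology :: "('a::chilbert_space \<Rightarrow>\<^sub>L 'a) topology" where
  "weak_operator_topology =
     pullback_topology cbounded (\<lambda>A (x, y). cinner (blinfun_apply A x) y) euclidean"

definition op_algebra :: "('a::chilbert_space \<Rightarrow>\<^sub>L 'a) set \<Rightarrow> bool" where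
  "op_algebra S \<longleftrightarrow> S \<subseteq> cbounded \<and> 0 \<in> S \<and>
     (\<forall>A\<in>S. \<forall>B\<in>S. A + B \<in> S \<and> A o\<^sub>L B \<in> S) \<and> (\<forall>c. \<forall>A\<in>S. scaleC_op c A \<in> S)"

definition wot_algebra_generated :: "('a::chilbert_space \<Rightarrow>\<^sub>L 'a) set \<Rightarrow> ('a \<Rightarrow>\<^sub>L 'a) set" where
  "wot_algebra_generated X = (\<lambda>S. op_algebra S \<and> closedin weak_operator_topology S) hull X"

definition contractive_homomorphism ::
  "('a::chilbert_space \<Rightarrow>\<^sub>L 'a) set \<Rightarrow> (('a \<Rightarrow>\<^sub>L 'a) \<Rightarrow> ('b::chilbert_space \<Rightarrow>\<^sub>L 'b)) \<Rightarrow> bool" where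
  "contractive_homomorphism S \<Psi> \<longleftrightarrow>
     (\<forall>A\<in>S. \<Psi> A \<in> cbounded \<and> norm (\<Psi> A) \<le> norm A) \<and>
     (\<forall>A\<in>S. \<forall>B\<in>S. \<Psi> (A + B) = \<Psi> A + \<Psi> B \<and> \<Psi> (A o\<^sub>L B) = \<Psi> A o\<^sub>L \<Psi> B) \<and>
     (\<forall>c. \<forall>A\<in>S. \<Psi> (scaleC_op c A) = scaleC_op c (\<Psi> A))"


section \<open>The free semigroupoid\<close>

text \<open>
  Sources and ranges of edges are tails and heads.  An element of the free semigroupoid is a
  pair of its source vertex and the list of its edges in the order in which they are
  traversed: the path \<open>e\<^sub>k \<cdots> e\<^sub>1\<close> is \<open>(s(e\<^sub>1), [e\<^sub>1, \<dots>, e\<^sub>k])\<close>, and the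
  vertex \<open>x\<close> is \<open>(x, [])\<close>.
\<close>

type_synonym ('v, 'e) fpath = "'v \<times> 'e list"

definition no_sinks :: "('v, 'e) pre_digraph \<Rightarrow> bool" where
  "no_sinks G \<longleftrightarrow> (\<forall>x\<in>verts G. \<exists>e\<in>arcs G. tail G e = x)"

definition free_semigroupoid :: "('v, 'e) pre_digraph \<Rightarrow> ('v, 'e) fpath set" where
  "free_semigroupoid G = {(u, p). \<exists>v. pre_digraph.awalk G u p v}"

definition paths_of_length :: "('v, 'e) pre_digraph \<Rightarrow> nat \<Rightarrow> ('v, 'e) fpath set" where
  "paths_of_length G d = {w \<in> free_semigroupoid G. length (snd w) = d}"

definition path_range :: "('v, 'e) pre_digraph \<Rightarrow> ('v, 'e) fpath \<Rightarrow> 'v" where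
  "path_range G w = last (pre_digraph.awalk_verts G (fst w) (snd w))"

definition extend_path :: "'e \<Rightarrow> ('v, 'e) fpath \<Rightarrow> ('v, 'e) fpath" where
  "extend_path e w = (fst w, snd w @ [e])"

text \<open>
  The operator \<open>w(T) = T\<^bsub>e\<^sub>k\<^esub> \<cdots> T\<^bsub>e\<^sub>1\<^esub>\<close>.  It depends on the edges of \<open>w\<close> only and is
  meant for paths of positive length.
\<close>

definition path_op :: "('e \<Rightarrow> ('a::chilbert_space \<Rightarrow>\<^sub>L 'a)) \<Rightarrow> ('v, 'e) fpath \<Rightarrow> ('a \<Rightarrow>\<^sub>L 'a)" where
  "path_op T w = fold (\<lambda>e A. T e o\<^sub>L A) (snd w) id_blinfun"


section \<open>Free semigroupoid algebras\<close>

text \<open>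
  The space \<open>\<H>\<^sub>G\<close> is any Hilbert space with an orthonormal basis \<open>\<xi>\<close> indexed by the free
  semigroupoid; only the values of \<open>\<xi>\<close> on the free semigroupoid matter.
\<close>

definition orthonormal_basis_on :: "'i set \<Rightarrow> ('i \<Rightarrow> 'a::chilbert_space) \<Rightarrow> bool" where
  "orthonormal_basis_on I \<xi> \<longleftrightarrow>
     (\<forall>i\<in>I. \<forall>j\<in>I. cinner (\<xi> i) (\<xi> j) = (if i = j then 1 else 0)) \<and>
     closure (cspan (\<xi> ` I)) = UNIV"

definition creation_op ::
  "('v, 'e) pre_digraph \<Rightarrow> (('v, 'e) fpath \<Rightarrow> 'a::chilbert_space) \<Rightarrow> 'e \<Rightarrow> ('a \<Rightarrow>\<^sub>L 'a)" where
  "creation_op G \<xi> e = (THE A. A \<in> cbounded \<and> (\<forall>w\<in>free_semigroupoid G.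
     A (\<xi> w) = (if path_range G w = tail G e then \<xi> (extend_path e w) else 0)))"

definition vertex_projection ::
  "('v, 'e) pre_digraph \<Rightarrow> (('v, 'e) fpath \<Rightarrow> 'a::chilbert_space) \<Rightarrow> 'v \<Rightarrow> ('a \<Rightarrow>\<^sub>L 'a)" where
  "vertex_projection G \<xi> x =
     projection_onto (closure (cspan (\<xi> ` {w \<in> free_semigroupoid G. path_range G w = x})))"

definition free_semigroupoid_algebra ::
  "('v, 'e) pre_digraph \<Rightarrow> (('v, 'e) fpath \<Rightarrow> 'a::chilbert_space) \<Rightarrow> ('a \<Rightarrow>\<^sub>L 'a) set" where
  "free_semigroupoid_algebra G \<xi> =
     wot_algebra_generated (creation_op G \<xi> ` arcs G \<union> vertex_projection G \<xi> ` verts G)"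


section \<open>Stabilized row contractions\<close>

text \<open>Infinite sums of operators are taken in the strong operator topology.\<close>

definition row_contraction :: "'e set \<Rightarrow> ('e \<Rightarrow> ('a::chilbert_space \<Rightarrow>\<^sub>L 'a)) \<Rightarrow> bool" where
  "row_contraction E T \<longleftrightarrow> (\<forall>e\<in>E. T e \<in> cbounded \<and> T e \<noteq> 0) \<and>
     (\<exists>S\<in>cbounded. (\<forall>h. ((\<lambda>e. (T e o\<^sub>L cadjoint (T e)) h) has_sum blinfun_apply S h) E) \<and> op_le S id_blinfun)"

definition stabilized_by ::
  "('v, 'e) pre_digraph \<Rightarrow> ('e \<Rightarrow> ('a::chilbert_space \<Rightarrow>\<^sub>L 'a)) \<Rightarrow> ('v \<Rightarrow> ('a \<Rightarrow>\<^sub>L 'a)) \<Rightarrow> bool" where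
  "stabilized_by G T P \<longleftrightarrow>
     (\<forall>x\<in>verts G. is_projection (P x)) \<and>
     (\<forall>x\<in>verts G. \<forall>y\<in>verts G. x \<noteq> y \<longrightarrow> P x o\<^sub>L P y = 0) \<and>
     (\<forall>h. ((\<lambda>x. P x h) has_sum h) (verts G)) \<and>
     (\<forall>e\<in>arcs G. \<forall>x\<in>verts G. T e o\<^sub>L P x \<in> {T e, 0} \<and> P x o\<^sub>L T e \<in> {T e, 0}) \<and>
     (\<forall>e\<in>arcs G. P (head G e) o\<^sub>L T e o\<^sub>L P (tail G e) = T e)"

end

theory Submission
  imports Defs
begin

text \<open>
  Write \<open>w(T)\<close> for the projection \<open>P'\<^sub>x\<close> when \<open>w\<close> is a vertex \<open>x\<close>, and let
  \<open>\<Delta> = 1 - \<Sum>\<^sub>e T\<^sub>e T\<^sub>e\<^sup>*\<close>. The sums \<open>\<Sum>\<^bsub>|w| = d\<^esub> \<parallel>w(T)\<^sup>* h\<parallel>\<^sup>2\<close> start at \<open>\<parallel>h\<parallel>\<^sup>2\<close>, tend to zero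
  by hypothesis, and drop by \<open>\<Sum>\<^bsub>|w| = d\<^esub> \<langle>\<Delta> w(T)\<^sup>* h, w(T)\<^sup>* h\<rangle>\<close> in step \<open>d\<close>. Hence
  \<open>\<Sum>\<^sub>w \<langle>\<Delta> w(T)\<^sup>* h, w(T)\<^sup>* h\<rangle> = \<parallel>h\<parallel>\<^sup>2\<close> (\<open>path_resolution\<close>), so that
  \<open>K h = \<Sum>\<^sub>w \<xi>\<^sub>w \<otimes> \<Delta>\<^bsup>1/2\<^esup> w(T)\<^sup>* h\<close> is an isometry of \<open>\<H>\<close> into \<open>\<H>\<^sub>G \<otimes> \<H>\<close>, and the
  representation is \<open>calculus A = K\<^sup>* (A \<otimes> 1) K\<close>.

  The tensor product and the square root can be bypassed. For a vector \<open>k\<close> let \<open>\<theta>\<^sub>k : \<H>\<^sub>G \<rightarrow> \<H>\<close>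
  send \<open>\<xi>\<^sub>w\<close> to \<open>w(T) \<Delta> k\<close>. The vectors \<open>w(T) \<Delta> k\<close> span a dense subspace, so the relations
  \<open>X \<theta>\<^sub>k = \<theta>\<^sub>k A\<close> for all \<open>k\<close> determine \<open>X = calculus A\<close>, make \<open>calculus\<close> a homomorphism, and
  can be checked on basis vectors for the generators. They also imply \<open>\<parallel>X\<parallel> \<le> \<parallel>A\<parallel>\<close>
  (\<open>intertwined_norm_le\<close>): orthonormalizing finitely many vectors for the form \<open>\<langle>\<Delta> x, y\<rangle>\<close>
  exhibits \<open>X\<close> as a compression of a finite direct sum of copies of \<open>A\<close>, up to an arbitrarily
  small error.

  What remains is the existence of \<open>X\<close> for every \<open>A\<close> in the algebra, and it cannot be obtained
  by continuity from the generators: the compression of \<open>A \<otimes> 1\<close> is weak-operator continuous in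
  \<open>A\<close> on bounded sets, but a priori not beyond. Instead, every \<open>A\<close> in the algebra commutes
  with the right creation operators \<open>R\<^sub>v \<xi>\<^sub>u = \<xi>\<^bsub>u v\<^esub>\<close>, because the commutant of these is an
  algebra that is closed in the weak operator topology and contains the generators
  (\<open>algebra_subset_right_commutant\<close>). Such an \<open>A\<close> satisfies \<open>A \<xi>\<^sub>z = R\<^sub>z A \<xi>\<^bsub>r(z)\<^esub>\<close>, so it has
  Fourier coefficients \<open>a\<^sub>u = \<langle>A \<xi>\<^bsub>s(u)\<^esub>, \<xi>\<^sub>u\<rangle>\<close>, and \<open>X\<close> should be \<open>\<Sum>\<^sub>u a\<^sub>u u(T)\<close>. This series
  need not converge, but \<open>X\<^sub>r = \<Sum>\<^sub>u a\<^sub>u r\<^bsup>|u|\<^esup> u(T)\<close> does for \<open>r < 1\<close>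
  (\<open>scaled_calculus_exists\<close>). The operator \<open>X\<^sub>r\<close> has the intertwining property for the row
  contraction \<open>r T\<close>, hence \<open>\<parallel>X\<^sub>r\<parallel> \<le> \<parallel>A\<parallel>\<close>, and as \<open>r\<close> tends to \<open>1\<close> it converges on the vectors
  \<open>w(T) \<Delta> k\<close> to what \<open>X\<close> has to be there (\<open>calculus_exists\<close>).
\<close>

section \<open>Complex Hilbert spaces and adjoints\<close>

lemma cinner_add_right: "cinner x (y + z) = cinner x y + cinner x z"
  by (metis cinner_add_left cinner_commute complex_cnj_add)

lemma cinner_scaleC_right: "cinner x (c *\<^sub>C y) = cnj c * cinner x y"
  by (metis cinner_scaleC_left cinner_commute complex_cnj_mult)

text \<open>
  Rotating \<open>x\<close> by a phase makes \<open>\<langle>x, y\<rangle>\<close> real and nonnegative without changing norms, which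
  reduces the claim to the real part of the inner product.
\<close>

lemma norm_cinner_le: "cmod (cinner x y) \<le> norm x * norm y"
proof -
  define c where "c = (if cinner x y = 0 then 1 else cnj (cinner x y) / of_real (cmod (cinner x y)))"
  have c: "cmod c = 1" by (simp add: c_def norm_divide)
  have "c * cinner x y = of_real (cmod (cinner x y))"
    using complex_norm_square[of "cinner x y"]
    by (auto simp: c_def mult.commute power2_eq_square divide_eq_eq)
  then have "cmod (cinner x y) = Re (cinner (c *\<^sub>C x) y)"
    by (simp add: cinner_scaleC_left)
  also have "\<dots> \<le> norm (c *\<^sub>C x) * norm y"
    by (simp add: Re_cinner norm_cauchy_schwarz)
  finally show ?thesis by (simp add: norm_scaleC c)
qed

global_interpretation cinner: bounded_bilinear "cinner :: 'a::chilbert_space \<Rightarrow> 'a \<Rightarrow> complex"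
proof
  show "cinner (r *\<^sub>R a) b = r *\<^sub>R cinner a b" for r and a b :: 'a
    by (simp add: scaleC_of_real[symmetric] cinner_scaleC_left scaleR_conv_of_real)
  show "cinner a (r *\<^sub>R b) = r *\<^sub>R cinner a b" for r and a b :: 'a
    by (simp add: scaleC_of_real[symmetric] cinner_scaleC_right scaleR_conv_of_real)
  show "\<exists>K. \<forall>(a::'a) b. cmod (cinner a b) \<le> norm a * norm b * K"
    using norm_cinner_le by (intro exI[of _ 1]) auto
qed (simp_all add: cinner_add_left cinner_add_right)

global_interpretation scaleC: bounded_bilinear "scaleC :: complex \<Rightarrow> 'a \<Rightarrow> 'a::chilbert_space"
proof
  show "(r *\<^sub>R c) *\<^sub>C x = r *\<^sub>R (c *\<^sub>C x)" for r c and x :: 'a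
    by (simp add: scaleC_of_real[symmetric] scaleC_scaleC scaleR_conv_of_real)
  show "c *\<^sub>C (r *\<^sub>R x) = r *\<^sub>R (c *\<^sub>C x)" for r c and x :: 'a
    by (simp add: scaleC_of_real[symmetric] scaleC_scaleC mult.commute)
  show "\<exists>K. \<forall>c (x::'a). norm (c *\<^sub>C x) \<le> cmod c * norm x * K"
    by (intro exI[of _ 1]) (simp add: norm_scaleC)
qed (simp_all add: scaleC_add_left scaleC_add_right)

lemma cinner_eq_zeroI:
  assumes "\<And>y. cinner x y = 0" shows "x = 0"
  using assms[of x] by (simp add: cinner_self)

lemma cinner_ext_left:
  assumes "\<And>y. cinner x y = cinner x' y" shows "x = x'"
  using cinner_eq_zeroI[of "x - x'"] assms by (simp add: cinner.diff_left)

lemma cinner_ext_right: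
  assumes "\<And>x. cinner x y = cinner x y'" shows "y = y'"
  using cinner_ext_left[of y y'] assms by (metis cinner_commute)

lemma norm_le_if_cinner_le:
  assumes "0 \<le> M" and "\<And>g. cmod (cinner x g) \<le> M * norm g"
  shows "norm x \<le> M"
proof (cases "x = 0")
  case False
  have "norm x * norm x \<le> M * norm x"
    using assms(2)[of x] by (simp add: cinner_self power2_eq_square norm_mult)
  with False show ?thesis by simp
qed (use assms in simp)

text \<open>
  The representing vector minimizes \<open>J x = \<parallel>x\<parallel>\<^sup>2 / 2 - f x\<close>: by the parallelogram law every
  minimizing sequence is Cauchy, and at the minimum the derivative \<open>\<langle>y, x\<rangle> - f x\<close> vanishes in
  every direction \<open>x\<close>.
\<close>

lemma riesz_representation_real:
  fixes f :: "'a::{real_inner,banach} \<Rightarrow> real"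
  assumes f: "bounded_linear f"
  shows "\<exists>y. \<forall>x. f x = inner x y"
proof -
  interpret f: bounded_linear f by fact
  define J where "J x = (norm x)\<^sup>2 / 2 - f x" for x
  obtain K where K: "\<And>x. norm (f x) \<le> norm x * K" using f.bounded by blast
  have J_ge: "- (K\<^sup>2 / 2) \<le> J x" for x
  proof -
    have "0 \<le> (norm x - K)\<^sup>2" by simp
    moreover have "f x \<le> norm x * K" using K[of x] by simp
    ultimately show ?thesis unfolding J_def by (simp add: power2_diff)
  qed
  define m where "m = Inf (range J)"
  have bdd: "bdd_below (range J)" using J_ge by (intro bdd_belowI2)
  have m_le: "m \<le> J x" for x unfolding m_def by (rule cInf_lower[OF _ bdd]) simp
  define ep where "ep n = 1 / real (Suc n)" for n
  have ep_pos: "0 < ep n" for n by (simp add: ep_def)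
  have "\<exists>x. J x < m + ep n" for n
  proof -
    have "Inf (range J) < m + ep n" using ep_pos[of n] by (simp add: m_def)
    then show ?thesis by (subst (asm) cInf_less_iff) (use bdd in auto)
  qed
  then obtain X where X: "\<And>n. J (X n) < m + ep n" by metis
  have par: "(norm (x - y))\<^sup>2 = 4 * (J x + J y - 2 * J ((1/2) *\<^sub>R (x + y)))" for x y
    unfolding J_def f.scaleR f.add power2_norm_eq_inner
    by (simp add: inner_commute inner_diff inner_add field_simps)
  have X_dist: "(norm (X n - X k))\<^sup>2 \<le> 4 * (ep n + ep k)" for n k
    using par[of "X n" "X k"] X[of n] X[of k] m_le[of "(1/2) *\<^sub>R (X n + X k)"] by argo
  have "Cauchy X"
  proof (rule metric_CauchyI)
    fix e :: real assume "e > 0"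
    have ep0: "ep \<longlonglongrightarrow> 0" unfolding ep_def by (rule LIMSEQ_Suc[OF lim_1_over_n])
    have "eventually (\<lambda>n. ep n < e\<^sup>2 / 8) sequentially"
      by (rule order_tendstoD(2)[OF ep0]) (use \<open>e > 0\<close> in simp)
    then obtain N where N: "\<And>n. n \<ge> N \<Longrightarrow> ep n < e\<^sup>2 / 8"
      unfolding eventually_sequentially by blast
    show "\<exists>M. \<forall>m\<ge>M. \<forall>n\<ge>M. dist (X m) (X n) < e"
    proof (intro exI allI impI)
      fix k n assume kn: "k \<ge> N" "n \<ge> N"
      have "(norm (X k - X n))\<^sup>2 < e\<^sup>2"
        using X_dist[of k n] N[OF kn(1)] N[OF kn(2)] by argo
      then show "dist (X k) (X n) < e"
        using \<open>e > 0\<close> power2_less_imp_less[of "norm (X k - X n)" e] by (simp add: dist_norm)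
    qed
  qed
  then obtain y where y: "X \<longlonglongrightarrow> y" using Cauchy_convergent convergentD by blast
  have "(\<lambda>n. J (X n)) \<longlonglongrightarrow> J y" unfolding J_def by (intro tendsto_intros y f.tendsto) simp
  moreover have "(\<lambda>n. m + ep n) \<longlonglongrightarrow> m + 0"
    using tendsto_add[OF tendsto_const LIMSEQ_Suc[OF lim_1_over_n]] unfolding ep_def .
  ultimately have "J y \<le> m + 0"
    by (rule LIMSEQ_le) (use X less_imp_le in blast)
  then have min: "J y \<le> J x" for x using m_le[of x] by simp
  have "f x = inner x y" for x
  proof -
    define a where "a = inner x y - f x"
    have q: "0 \<le> t * a + t\<^sup>2 * ((norm x)\<^sup>2 / 2)" for t
    proof -
      have "J (y + t *\<^sub>R x) - J y = t * a + t\<^sup>2 * ((norm x)\<^sup>2 / 2)"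
        unfolding J_def a_def f.scaleR f.add power2_norm_eq_inner
        by (simp add: inner_simps inner_commute power2_eq_square algebra_simps add_divide_distrib)
      with min show ?thesis by (metis diff_ge_0_iff_ge)
    qed
    define Q where "Q = (norm x)\<^sup>2 / 2"
    have Q: "Q \<ge> 0" by (simp add: Q_def)
    \<comment> \<open>the slope at \<open>y\<close> is \<open>a\<close>; a small step against it would decrease \<open>J\<close> unless \<open>a = 0\<close>\<close>
    define t where "t = - a / (Q + 1)"
    have ta: "a = - t * (Q + 1)" using Q by (simp add: t_def)
    have "0 \<le> t * a + t\<^sup>2 * Q" using q[of t] by (simp add: Q_def)
    also have "t * a + t\<^sup>2 * Q = - t\<^sup>2" by (simp add: ta power2_eq_square algebra_simps)
    finally have "t = 0" by simp
    then have "a = 0" by (simp add: ta)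
    then show ?thesis by (simp add: a_def)
  qed
  then show ?thesis by blast
qed

lemma riesz_representation:
  fixes f :: "'a::chilbert_space \<Rightarrow> complex"
  assumes f: "bounded_linear f" and fC: "\<And>c x. f (c *\<^sub>C x) = c * f x"
  shows "\<exists>y. \<forall>x. f x = cinner x y"
proof -
  obtain y where y: "\<And>x. Re (f x) = inner x y"
    using riesz_representation_real[OF bounded_linear_compose[OF bounded_linear_Re f]] by blast
  have "f x = cinner x y" for x
  proof (rule complex_eqI)
    have *: "Re (f z) = Re (cinner z y)" for z by (simp add: y Re_cinner)
    show "Re (f x) = Re (cinner x y)" by (rule *)
    show "Im (f x) = Im (cinner x y)"
      using *[of "\<i> *\<^sub>C x"] by (simp add: fC cinner_scaleC_left)
  qed
  then show ?thesis by blast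
qed

lemma cbounded_scaleC: "A \<in> cbounded \<Longrightarrow> blinfun_apply A (c *\<^sub>C x) = c *\<^sub>C blinfun_apply A x"
  by (simp add: cbounded_def)

lemma cbounded_comp [intro, simp]: "A \<in> cbounded \<Longrightarrow> B \<in> cbounded \<Longrightarrow> A o\<^sub>L B \<in> cbounded"
  by (simp add: cbounded_def)

lemma cbounded_add [intro, simp]: "A \<in> cbounded \<Longrightarrow> B \<in> cbounded \<Longrightarrow> A + B \<in> cbounded"
  by (simp add: cbounded_def blinfun.add_left scaleC_add_right)

lemma cbounded_diff [intro, simp]: "A \<in> cbounded \<Longrightarrow> B \<in> cbounded \<Longrightarrow> A - B \<in> cbounded"
  by (simp add: cbounded_def blinfun.diff_left scaleC.diff_right)

lemma cbounded_zero [intro, simp]: "0 \<in> cbounded"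
  by (simp add: cbounded_def)

lemma cbounded_id [intro, simp]: "id_blinfun \<in> cbounded"
  by (simp add: cbounded_def)

lemma cbounded_scaleC_op [intro, simp]: "A \<in> cbounded \<Longrightarrow> scaleC_op c A \<in> cbounded"
  by (simp add: cbounded_def scaleC_op.rep_eq scaleC_scaleC mult.commute)

lemma cbounded_scaleR [intro, simp]: "A \<in> cbounded \<Longrightarrow> r *\<^sub>R A \<in> cbounded"
  by (simp add: cbounded_def blinfun.scaleR_left scaleC.scaleR_right)

lemma cadjoint_eqI:
  assumes "B \<in> cbounded" and "\<And>x y. cinner (blinfun_apply A x) y = cinner x (blinfun_apply B y)"
  shows "cadjoint A = B"
  unfolding cadjoint_def
proof (rule the_equality)
  fix B' :: "'a \<Rightarrow>\<^sub>L 'a"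
  assume B': "B' \<in> cbounded \<and> (\<forall>x y. cinner (blinfun_apply A x) y = cinner x (blinfun_apply B' y))"
  show "B' = B"
    by (rule blinfun_eqI, rule cinner_ext_right) (use assms B' in metis)
qed (use assms in blast)

text \<open>
  Justifies the definite description in \<^const>\<open>cadjoint\<close>; all later facts about adjoints rest on
  it.
\<close>

lemma adjoint_exists:
  fixes A :: "'a::chilbert_space \<Rightarrow>\<^sub>L 'a"
  assumes A: "A \<in> cbounded"
  shows "\<exists>B\<in>cbounded. \<forall>x y. cinner (blinfun_apply A x) y = cinner x (blinfun_apply B y)"
proof -
  have "\<exists>z. \<forall>x. cinner (blinfun_apply A x) y = cinner x z" for y
  proof (rule riesz_representation)
    show "bounded_linear (\<lambda>x. cinner (blinfun_apply A x) y)"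
      by (rule bounded_linear_compose[OF cinner.bounded_linear_left blinfun.bounded_linear_right])
  qed (simp add: cbounded_scaleC[OF A] cinner_scaleC_left)
  then obtain B where B: "\<And>x y. cinner (blinfun_apply A x) y = cinner x (B y)" by metis
  have lin: "bounded_linear B"
  proof (rule bounded_linear_intro[where K = "norm A"])
    show "B (x + y) = B x + B y" for x y
      by (rule cinner_ext_right) (simp add: B[symmetric] cinner_add_right)
    show "B (r *\<^sub>R x) = r *\<^sub>R B x" for r x
      by (rule cinner_ext_right) (simp add: B[symmetric] cinner.scaleR_right)
    show "norm (B x) \<le> norm x * norm A" for x
    proof (rule norm_le_if_cinner_le)
      fix g
      have "cmod (cinner (B x) g) = cmod (cinner (blinfun_apply A g) x)"
        by (metis B cinner_commute complex_mod_cnj)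
      also have "\<dots> \<le> norm (blinfun_apply A g) * norm x" by (rule norm_cinner_le)
      also have "\<dots> \<le> norm A * norm g * norm x" by (intro mult_right_mono norm_blinfun) auto
      finally show "cmod (cinner (B x) g) \<le> norm x * norm A * norm g" by (simp add: mult_ac)
    qed simp
  qed
  have ap: "blinfun_apply (Blinfun B) = B" by (rule bounded_linear_Blinfun_apply[OF lin])
  show ?thesis
  proof (intro bexI[of _ "Blinfun B"] allI)
    show "Blinfun B \<in> cbounded"
      unfolding cbounded_def mem_Collect_eq ap
      by (intro allI, rule cinner_ext_right) (simp add: B[symmetric] cinner_scaleC_right)
  qed (simp add: ap B)
qed

lemma
  assumes "A \<in> cbounded"
  shows cadjoint_cbounded [simp, intro]: "cadjoint A \<in> cbounded"
    and cinner_cadjoint: "cinner (blinfun_apply A x) y = cinner x (blinfun_apply (cadjoint A) y)"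
  using adjoint_exists[OF assms] cadjoint_eqI[of _ A] by blast+

lemma cadjoint_comp:
  "A \<in> cbounded \<Longrightarrow> B \<in> cbounded \<Longrightarrow> cadjoint (A o\<^sub>L B) = cadjoint B o\<^sub>L cadjoint A"
  by (rule cadjoint_eqI) (simp_all add: cinner_cadjoint)

lemma cadjoint_scaleR: "A \<in> cbounded \<Longrightarrow> cadjoint (r *\<^sub>R A) = r *\<^sub>R cadjoint A"
  by (rule cadjoint_eqI)
     (simp_all add: cinner_cadjoint blinfun.scaleR_left cinner.scaleR_left cinner.scaleR_right)

text \<open>
  Each of the two projections fixes the common range, so \<open>A B = B\<close> and \<open>B A = A\<close>; the adjoint
  of the second identity is \<open>A B = A\<close>.
\<close>

lemma projection_unique:
  assumes "is_projection A" "is_projection B" "range (blinfun_apply A) = range (blinfun_apply B)"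
  shows "A = B"
proof -
  have c: "A \<in> cbounded" "B \<in> cbounded" using assms by (auto simp: is_projection_def)
  have absorb: "X o\<^sub>L Y = Y" if idem: "X o\<^sub>L X = X" and sub: "range (blinfun_apply Y) \<subseteq> range (blinfun_apply X)"
    for X Y :: "'z::chilbert_space \<Rightarrow>\<^sub>L 'z"
  proof (rule blinfun_eqI)
    fix f
    obtain g where "Y f = X g" using sub by blast
    moreover have "X (X g) = X g" using idem by (metis blinfun_apply_blinfun_compose)
    ultimately show "(X o\<^sub>L Y) f = Y f" by simp
  qed
  have "A o\<^sub>L B = B" "B o\<^sub>L A = A" using assms by (auto simp: is_projection_def intro!: absorb)
  moreover have "cadjoint (B o\<^sub>L A) = A o\<^sub>L B" using assms c by (simp add: cadjoint_comp is_projection_def)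
  moreover have "cadjoint A = A" using assms by (simp add: is_projection_def)
  ultimately show ?thesis by metis
qed

section \<open>Unconditional sums and strong limits\<close>

text \<open>
  The criterion by which the infinite sums of vectors constructed below converge. They are
  orthogonal series or images of such under bounded operators, and need not converge
  absolutely; but the norm of a finite subsum is controlled by a convergent series of squares,
  which gives the Cauchy property.
\<close>

lemma square_dominated_summable:
  fixes x :: "'i \<Rightarrow> 'a::banach"
  assumes dom: "\<And>F. finite F \<Longrightarrow> F \<subseteq> I \<Longrightarrow> (norm (sum x F))\<^sup>2 \<le> C * sum b F"
    and b: "b summable_on I" and b0: "\<And>i. i \<in> I \<Longrightarrow> 0 \<le> b i" and C: "0 \<le> C"
  shows "x summable_on I" and "(norm (infsum x I))\<^sup>2 \<le> C * infsum b I"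
proof -
  have "\<exists>P. eventually P (finite_subsets_at_top I) \<and>
              (\<forall>F F'. P F \<and> P F' \<longrightarrow> dist (sum x F) (sum x F') < e)" if "e > 0" for e
  proof -
    define d where "d = (e/4)\<^sup>2 / (C + 1)"
    have "d > 0" using that C by (simp add: d_def)
    then obtain F0 where F0: "finite F0" "F0 \<subseteq> I" "dist (sum b F0) (infsum b I) \<le> d"
      using infsum_finite_approximation[OF b] by blast
    have near: "norm (sum x F - sum x F0) \<le> e/4" if F: "finite F" "F0 \<subseteq> F" "F \<subseteq> I" for F
    proof -
      have "sum b F - sum b F0 \<le> d"
        using finite_sum_le_infsum[OF b F(1,3)] b0 F0(3) by (auto simp: dist_real_def)
      moreover have "sum b (F - F0) = sum b F - sum b F0" using F by (simp add: sum_diff)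
      ultimately have *: "sum b (F - F0) \<le> d" by simp
      have "(norm (sum x F - sum x F0))\<^sup>2 = (norm (sum x (F - F0)))\<^sup>2"
        using F by (simp add: sum_diff)
      also have "\<dots> \<le> C * sum b (F - F0)" using F by (intro dom) auto
      also have "\<dots> \<le> C * d" using * C by (rule mult_left_mono)
      also have "\<dots> \<le> (C + 1) * d" using \<open>d > 0\<close> by simp
      also have "\<dots> = (e/4)\<^sup>2" using C by (simp add: d_def del: power_divide)
      finally have "(norm (sum x F - sum x F0))\<^sup>2 \<le> (e/4)\<^sup>2" .
      then show ?thesis by (rule power2_le_imp_le) (use \<open>e > 0\<close> in simp)
    qed
    show ?thesis
    proof (intro exI conjI allI impI)
      show "eventually (\<lambda>F. finite F \<and> F0 \<subseteq> F \<and> F \<subseteq> I) (finite_subsets_at_top I)"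
        unfolding eventually_finite_subsets_at_top using F0 by blast
      fix F F' assume "(finite F \<and> F0 \<subseteq> F \<and> F \<subseteq> I) \<and> finite F' \<and> F0 \<subseteq> F' \<and> F' \<subseteq> I"
      then have "dist (sum x F) (sum x F0) \<le> e/4" "dist (sum x F') (sum x F0) \<le> e/4"
        using near by (auto simp: dist_norm)
      with \<open>e > 0\<close> dist_triangle2[of "sum x F" "sum x F'" "sum x F0"]
      show "dist (sum x F) (sum x F') < e" by simp
    qed
  qed
  then have "cauchy_filter (filtermap (sum x) (finite_subsets_at_top I))"
    by (simp add: cauchy_filter_metric_filtermap)
  moreover have "complete (UNIV::'a set)"
    by (meson Cauchy_convergent UNIV_I complete_def convergent_def)
  ultimately obtain L' where "(sum x \<longlongrightarrow> L') (finite_subsets_at_top I)"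
    using complete_uniform[where S=UNIV] by (force simp add: filterlim_def)
  then show sm: "x summable_on I"
    using summable_on_def has_sum_def by blast
  have "((\<lambda>F. (norm (sum x F))\<^sup>2) \<longlongrightarrow> (norm (infsum x I))\<^sup>2) (finite_subsets_at_top I)"
    using has_sum_infsum[OF sm] unfolding has_sum_def by (intro tendsto_intros)
  moreover have "((\<lambda>F. C * sum b F) \<longlongrightarrow> C * infsum b I) (finite_subsets_at_top I)"
    using has_sum_infsum[OF b] unfolding has_sum_def by (intro tendsto_intros)
  moreover have "eventually (\<lambda>F. (norm (sum x F))\<^sup>2 \<le> C * sum b F) (finite_subsets_at_top I)"
    using dom by (intro eventually_finite_subsets_at_top_weakI)
  ultimately show "(norm (infsum x I))\<^sup>2 \<le> C * infsum b I"
    by (intro tendsto_le[of "finite_subsets_at_top I"]) auto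
qed

lemma nonneg_finite_sums_bounded:
  fixes b :: "'i \<Rightarrow> real"
  assumes "\<And>i. i \<in> I \<Longrightarrow> 0 \<le> b i" and "\<And>F. finite F \<Longrightarrow> F \<subseteq> I \<Longrightarrow> sum b F \<le> K"
  shows "b summable_on I" and "infsum b I \<le> K"
proof -
  show "b summable_on I"
    using assms by (intro nonneg_bdd_above_summable_on) (auto intro!: bdd_aboveI)
  then show "infsum b I \<le> K" using assms by (intro infsum_le_finite_sums)
qed

text \<open>
  The uniform bound makes the set of vectors at which the sequence is Cauchy a closed
  subspace.
\<close>

lemma strong_limit_exists:
  fixes X :: "nat \<Rightarrow> ('a::real_normed_vector \<Rightarrow>\<^sub>L 'b::banach)"
  assumes bnd: "\<And>n. norm (X n) \<le> K" and dense: "closure (span D) = UNIV"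
    and conv: "\<And>d. d \<in> D \<Longrightarrow> convergent (\<lambda>n. blinfun_apply (X n) d)"
  shows "\<exists>Y. norm Y \<le> K \<and> (\<forall>x. (\<lambda>n. blinfun_apply (X n) x) \<longlonglongrightarrow> blinfun_apply Y x)"
proof -
  have K: "0 \<le> K" using bnd[of 0] norm_ge_zero order_trans by blast
  have Xle: "norm (blinfun_apply (X n) x) \<le> K * norm x" for n x
    by (meson bnd mult_right_mono norm_blinfun norm_ge_zero order_trans)
  have "subspace {x. convergent (\<lambda>n. blinfun_apply (X n) x)}"
  proof (rule subspaceI, unfold mem_Collect_eq)
    show "convergent (\<lambda>n. blinfun_apply (X n) 0)" by (simp add: blinfun.zero_right convergent_const)
    fix x assume x: "convergent (\<lambda>n. blinfun_apply (X n) x)"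
    show "convergent (\<lambda>n. blinfun_apply (X n) (x + y))"
      if "convergent (\<lambda>n. blinfun_apply (X n) y)" for y
      using x that unfolding blinfun.add_right by (rule convergent_add)
    show "convergent (\<lambda>n. blinfun_apply (X n) (c *\<^sub>R x))" for c
    proof -
      obtain L where "(\<lambda>n. blinfun_apply (X n) x) \<longlonglongrightarrow> L" using x convergentD by blast
      then show ?thesis
        unfolding blinfun.scaleR_right by (rule convergentI[OF tendsto_scaleR[OF tendsto_const]])
    qed
  qed
  then have span: "convergent (\<lambda>n. blinfun_apply (X n) x)" if "x \<in> span D" for x
    using span_minimal[of D "{x. convergent (\<lambda>n. blinfun_apply (X n) x)}"] conv that by blast
  have "Cauchy (\<lambda>n. blinfun_apply (X n) x)" for x
  proof (rule metric_CauchyI)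
    fix e :: real assume e: "e > 0"
    define d where "d = e / (3 * (K + 1))"
    have d: "d > 0" using e K by (simp add: d_def)
    obtain y where y: "y \<in> span D" "dist y x < d"
      using dense d closure_approachable by (metis UNIV_I)
    from span[OF y(1)] have "Cauchy (\<lambda>n. blinfun_apply (X n) y)" by (rule convergent_Cauchy)
    then obtain M where M: "\<And>m n. m \<ge> M \<Longrightarrow> n \<ge> M \<Longrightarrow> dist (blinfun_apply (X m) y) (blinfun_apply (X n) y) < e/3"
      using metric_CauchyD[of _ "e/3"] e by (metis divide_pos_pos zero_less_numeral)
    have near: "dist (blinfun_apply (X n) x) (blinfun_apply (X n) y) \<le> e/3" for n
    proof -
      have "dist (blinfun_apply (X n) x) (blinfun_apply (X n) y) = norm (blinfun_apply (X n) (x - y))"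
        by (simp add: dist_norm blinfun.diff_right)
      also have "\<dots> \<le> K * norm (x - y)" by (rule Xle)
      also have "\<dots> \<le> (K + 1) * d"
        using y(2) K by (intro mult_mono) (auto simp: dist_norm norm_minus_commute)
      also have "\<dots> = e/3" using K by (simp add: d_def field_simps)
      finally show ?thesis .
    qed
    show "\<exists>M. \<forall>m\<ge>M. \<forall>n\<ge>M. dist (blinfun_apply (X m) x) (blinfun_apply (X n) x) < e"
    proof (intro exI allI impI)
      fix m n assume "m \<ge> M" "n \<ge> M"
      then show "dist (blinfun_apply (X m) x) (blinfun_apply (X n) x) < e"
        using M[of m n] near[of m] near[of n]
          dist_triangle[of "blinfun_apply (X m) x" "blinfun_apply (X n) x" "blinfun_apply (X m) y"]
          dist_triangle[of "blinfun_apply (X m) y" "blinfun_apply (X n) x" "blinfun_apply (X n) y"]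
        by (simp add: dist_commute)
    qed
  qed
  then have "\<exists>l. (\<lambda>n. blinfun_apply (X n) x) \<longlonglongrightarrow> l" for x
    using Cauchy_convergent convergentD by blast
  then obtain Y where Y: "\<And>x. (\<lambda>n. blinfun_apply (X n) x) \<longlonglongrightarrow> Y x" by metis
  have Yle: "norm (Y x) \<le> norm x * K" for x
    by (rule LIMSEQ_le_const2[OF tendsto_norm[OF Y]]) (use Xle in \<open>auto simp: mult.commute\<close>)
  have lin: "bounded_linear Y"
  proof (rule bounded_linear_intro[OF _ _ Yle])
    show "Y (x + y) = Y x + Y y" for x y
      by (rule LIMSEQ_unique[OF Y]) (simp add: blinfun.add_right tendsto_add Y)
    show "Y (r *\<^sub>R x) = r *\<^sub>R Y x" for r x
      by (rule LIMSEQ_unique[OF Y]) (simp add: blinfun.scaleR_right tendsto_scaleR Y)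
  qed
  have ap: "blinfun_apply (Blinfun Y) = Y" by (rule bounded_linear_Blinfun_apply[OF lin])
  show ?thesis
  proof (intro exI conjI allI)
    show "norm (Blinfun Y) \<le> K"
      using Yle K by (intro norm_blinfun_bound) (auto simp: ap mult.commute)
  qed (simp add: ap Y)
qed

section \<open>Orthonormal bases\<close>

text \<open>
  Bounded complex-linear maps between possibly different spaces; \<^const>\<open>cbounded\<close> covers
  endomorphisms only.
\<close>

definition clinear :: "('a::chilbert_space \<Rightarrow> 'b::chilbert_space) \<Rightarrow> bool" where
  "clinear f \<longleftrightarrow> bounded_linear f \<and> (\<forall>c x. f (c *\<^sub>C x) = c *\<^sub>C f x)"

lemma clinear_cbounded: "A \<in> cbounded \<Longrightarrow> clinear (blinfun_apply A)"
  by (simp add: clinear_def cbounded_def blinfun.bounded_linear_right)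

lemma clinear_compose: "clinear f \<Longrightarrow> clinear g \<Longrightarrow> clinear (\<lambda>x. f (g x))"
  by (auto simp: clinear_def intro: bounded_linear_compose)

lemma clinear_0: "clinear f \<Longrightarrow> f 0 = 0"
  by (simp add: clinear_def bounded_linear.linear linear_0)

locale onb =
  fixes I :: "'i set" and \<xi> :: "'i \<Rightarrow> 'k::chilbert_space"
  assumes onb: "orthonormal_basis_on I \<xi>"
begin

lemma orthonormal: "i \<in> I \<Longrightarrow> j \<in> I \<Longrightarrow> cinner (\<xi> i) (\<xi> j) = (if i = j then 1 else 0)"
  using onb unfolding orthonormal_basis_on_def by blast

lemma coefficient_sum:
  assumes "finite F" "F \<subseteq> I" "j \<in> I"
  shows "cinner (\<Sum>i\<in>F. c i *\<^sub>C \<xi> i) (\<xi> j) = (if j \<in> F then c j else 0)"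
proof -
  have "cinner (\<Sum>i\<in>F. c i *\<^sub>C \<xi> i) (\<xi> j) = (\<Sum>i\<in>F. if i = j then c j else 0)"
    unfolding cinner.sum_left
    by (intro sum.cong) (use assms in \<open>auto simp: cinner_scaleC_left orthonormal\<close>)
  then show ?thesis using assms by simp
qed

lemma norm_sum_square:
  assumes "finite F" "F \<subseteq> I"
  shows "(norm (\<Sum>i\<in>F. c i *\<^sub>C \<xi> i))\<^sup>2 = (\<Sum>i\<in>F. (cmod (c i))\<^sup>2)"
proof -
  let ?s = "\<Sum>i\<in>F. c i *\<^sub>C \<xi> i"
  have "complex_of_real ((norm ?s)\<^sup>2) = cinner ?s ?s" by (simp add: cinner_self)
  also have "\<dots> = (\<Sum>j\<in>F. cnj (c j) * cinner ?s (\<xi> j))"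
    by (simp add: cinner.sum_right cinner_scaleC_right)
  also have "\<dots> = (\<Sum>j\<in>F. cnj (c j) * c j)"
  proof (intro sum.cong refl)
    fix j assume "j \<in> F"
    then show "cnj (c j) * cinner ?s (\<xi> j) = cnj (c j) * c j"
      using coefficient_sum[OF assms, of j c] assms(2) by auto
  qed
  also have "\<dots> = complex_of_real (\<Sum>i\<in>F. (cmod (c i))\<^sup>2)"
    unfolding of_real_sum complex_norm_square by (simp add: mult.commute)
  finally show ?thesis by (simp only: of_real_eq_iff)
qed

lemma bessel:
  assumes F: "finite F" "F \<subseteq> I"
  shows "(\<Sum>i\<in>F. (cmod (cinner f (\<xi> i)))\<^sup>2) \<le> (norm f)\<^sup>2"
proof -
  let ?s = "\<Sum>i\<in>F. cinner f (\<xi> i) *\<^sub>C \<xi> i"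
  let ?n = "\<Sum>i\<in>F. (cmod (cinner f (\<xi> i)))\<^sup>2"
  have "cinner f ?s = (\<Sum>i\<in>F. cnj (cinner f (\<xi> i)) * cinner f (\<xi> i))"
    by (simp add: cinner.sum_right cinner_scaleC_right)
  also have "\<dots> = complex_of_real ?n"
    unfolding of_real_sum complex_norm_square by (simp add: mult.commute)
  finally have "Re (cinner f ?s) = ?n" by simp
  then have "inner f ?s = ?n" by (simp only: Re_cinner)
  moreover have "(norm (f - ?s))\<^sup>2 = (norm f)\<^sup>2 - 2 * inner f ?s + (norm ?s)\<^sup>2"
    by (simp add: power2_norm_eq_inner inner_diff inner_commute)
  moreover have "(norm ?s)\<^sup>2 = ?n" using F by (rule norm_sum_square)
  ultimately show ?thesis by (smt (verit) zero_le_power2)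
qed

lemma bessel_summable:
  shows "(\<lambda>i. (cmod (cinner f (\<xi> i)))\<^sup>2) summable_on I"
    and "(\<Sum>\<^sub>\<infinity>i\<in>I. (cmod (cinner f (\<xi> i)))\<^sup>2) \<le> (norm f)\<^sup>2"
  using nonneg_finite_sums_bounded[of I "\<lambda>i. (cmod (cinner f (\<xi> i)))\<^sup>2" "(norm f)\<^sup>2"] bessel
  by simp_all

lemma orthogonal_to_basis:
  assumes "\<And>i. i \<in> I \<Longrightarrow> cinner (\<xi> i) x = 0"
  shows "x = 0"
proof -
  have "complex_vector.subspace {y. cinner y x = 0}"
    unfolding complex_vector.subspace_def by (simp add: cinner_add_left cinner_scaleC_left cinner.zero_left)
  then have "cspan (\<xi> ` I) \<subseteq> {y. cinner y x = 0}"
    using assms by (intro complex_vector.span_minimal) auto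
  moreover have "closed {y. cinner y x = 0}"
    by (intro closed_Collect_eq continuous_intros cinner.continuous_on)
  ultimately have "closure (cspan (\<xi> ` I)) \<subseteq> {y. cinner y x = 0}"
    by (rule closure_minimal)
  moreover have "closure (cspan (\<xi> ` I)) = UNIV"
    using onb by (simp add: orthonormal_basis_on_def)
  ultimately have "cinner x x = 0" by blast
  then show ?thesis by (simp add: cinner_self)
qed

lemma expansion: "((\<lambda>i. cinner f (\<xi> i) *\<^sub>C \<xi> i) has_sum f) I"
proof -
  have "(\<lambda>i. cinner f (\<xi> i) *\<^sub>C \<xi> i) summable_on I"
    by (rule square_dominated_summable(1)[where C = 1 and b = "\<lambda>i. (cmod (cinner f (\<xi> i)))\<^sup>2"])
       (simp_all add: norm_sum_square bessel_summable)
  then obtain s where s: "((\<lambda>i. cinner f (\<xi> i) *\<^sub>C \<xi> i) has_sum s) I"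
    unfolding summable_on_def by blast
  have "cinner (\<xi> j) (f - s) = 0" if j: "j \<in> I" for j
  proof -
    have "((\<lambda>i. cinner (cinner f (\<xi> i) *\<^sub>C \<xi> i) (\<xi> j)) has_sum cinner s (\<xi> j)) I"
      by (rule has_sum_bounded_linear[OF cinner.bounded_linear_left s])
    moreover have "((\<lambda>i. cinner (cinner f (\<xi> i) *\<^sub>C \<xi> i) (\<xi> j)) has_sum cinner f (\<xi> j)) I"
      by (rule has_sum_finite_neutralI[of "{j}"])
         (use j in \<open>auto simp: cinner_scaleC_left orthonormal\<close>)
    ultimately have "cinner s (\<xi> j) = cinner f (\<xi> j)" by (rule has_sum_unique)
    then show ?thesis by (metis cinner_commute cinner.diff_left complex_cnj_zero diff_self)
  qed
  then have "f = s" using orthogonal_to_basis by (metis eq_iff_diff_eq_0)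
  with s show ?thesis by simp
qed

lemma clinear_expansion:
  assumes M: "clinear M"
  shows "((\<lambda>i. cinner f (\<xi> i) *\<^sub>C M (\<xi> i)) has_sum M f) I"
  using has_sum_bounded_linear[OF _ expansion, of M f] M by (simp add: clinear_def)

lemma clinear_eqI:
  assumes "clinear M" "clinear N" and "\<And>i. i \<in> I \<Longrightarrow> M (\<xi> i) = N (\<xi> i)"
  shows "M f = N f"
proof (rule has_sum_unique)
  show "((\<lambda>i. cinner f (\<xi> i) *\<^sub>C M (\<xi> i)) has_sum M f) I" by (rule clinear_expansion[OF assms(1)])
  have "((\<lambda>i. cinner f (\<xi> i) *\<^sub>C N (\<xi> i)) has_sum N f) I" by (rule clinear_expansion[OF assms(2)])
  then show "((\<lambda>i. cinner f (\<xi> i) *\<^sub>C M (\<xi> i)) has_sum N f) I"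
    by (rule has_sum_cong[THEN iffD1, rotated]) (simp add: assms(3))
qed

text \<open>
  The map is \<open>f \<mapsto> \<Sum>\<^sub>i \<langle>f, \<xi>\<^sub>i\<rangle> v\<^sub>i\<close>; the hypothesis on finite combinations makes this series
  converge. All operators on or out of \<open>\<H>\<^sub>G\<close> are obtained in this way.
\<close>

lemma synthesis:
  fixes v :: "'i \<Rightarrow> 'b::chilbert_space"
  assumes C: "0 \<le> C"
    and dom: "\<And>F c. finite F \<Longrightarrow> F \<subseteq> I \<Longrightarrow>
      (norm (\<Sum>i\<in>F. c i *\<^sub>C v i))\<^sup>2 \<le> C * (\<Sum>i\<in>F. (cmod (c i))\<^sup>2)"
  shows "\<exists>M. clinear M \<and> (\<forall>i\<in>I. M (\<xi> i) = v i) \<and> (\<forall>f. norm (M f) \<le> norm f * sqrt C)"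
proof -
  define M where "M f = (\<Sum>\<^sub>\<infinity>i\<in>I. cinner f (\<xi> i) *\<^sub>C v i)" for f
  have summ: "(\<lambda>i. cinner f (\<xi> i) *\<^sub>C v i) summable_on I"
    and le: "(norm (M f))\<^sup>2 \<le> C * (\<Sum>\<^sub>\<infinity>i\<in>I. (cmod (cinner f (\<xi> i)))\<^sup>2)" for f
    unfolding M_def
    by (rule square_dominated_summable[where C = C and b = "\<lambda>i. (cmod (cinner f (\<xi> i)))\<^sup>2"];
        use C dom bessel_summable in simp)+
  have M: "((\<lambda>i. cinner f (\<xi> i) *\<^sub>C v i) has_sum M f) I" for f
    unfolding M_def using summ by (rule has_sum_infsum)
  have bl_scaleC: "bounded_linear (\<lambda>x::'b. c *\<^sub>C x)" for c by (rule scaleC.bounded_linear_right)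
  have C_lin: "M (c *\<^sub>C f) = c *\<^sub>C M f" for c f
    by (rule has_sum_unique[OF M])
       (use has_sum_bounded_linear[OF bl_scaleC M] in \<open>simp add: cinner_scaleC_left scaleC_scaleC\<close>)
  have bound: "norm (M f) \<le> norm f * sqrt C" for f
  proof (rule power2_le_imp_le)
    have "(norm (M f))\<^sup>2 \<le> C * (norm f)\<^sup>2"
      using le[of f] mult_left_mono[OF bessel_summable(2) C] by (rule order_trans)
    then show "(norm (M f))\<^sup>2 \<le> (norm f * sqrt C)\<^sup>2" using C by (simp add: power_mult_distrib mult.commute)
  qed (use C in simp)
  have "bounded_linear M"
  proof (rule bounded_linear_intro[OF _ _ bound])
    show "M (f + g) = M f + M g" for f g
      by (rule has_sum_unique[OF M])
         (use has_sum_add[OF M M] in \<open>simp add: cinner_add_left scaleC_add_left\<close>)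
    show "M (r *\<^sub>R f) = r *\<^sub>R M f" for r f
      using C_lin[of "of_real r" f] by (simp add: scaleC_of_real)
  qed
  moreover have "M (\<xi> j) = v j" if "j \<in> I" for j
  proof (rule has_sum_unique[OF M])
    show "((\<lambda>i. cinner (\<xi> j) (\<xi> i) *\<^sub>C v i) has_sum v j) I"
      by (rule has_sum_finite_neutralI[of "{j}"]) (use that in \<open>auto simp: orthonormal\<close>)
  qed
  ultimately show ?thesis using C_lin bound unfolding clinear_def by blast
qed

lemma basis_dense: "closure (span {c *\<^sub>C \<xi> i | c i. i \<in> I}) = UNIV" (is "closure (span ?D) = _")
proof -
  have "f \<in> closure (span ?D)" for f
  proof (rule Lim_in_closed_set)
    show "(sum (\<lambda>i. cinner f (\<xi> i) *\<^sub>C \<xi> i) \<longlongrightarrow> f) (finite_subsets_at_top I)"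
      using expansion by (simp add: has_sum_def)
    show "eventually (\<lambda>F. (\<Sum>i\<in>F. cinner f (\<xi> i) *\<^sub>C \<xi> i) \<in> closure (span ?D)) (finite_subsets_at_top I)"
      by (intro eventually_finite_subsets_at_top_weakI closure_subset[THEN subsetD] span_sum span_base)
         blast
  qed auto
  then show ?thesis by blast
qed

text \<open>
  Partial injections of the index set act on the basis as partial isometries. This one
  construction yields the left and right creation operators, the vertex projections and the
  diagonal operators \<open>\<xi>\<^sub>w \<mapsto> r\<^bsup>|w|\<^esup> \<xi>\<^sub>w\<close>.
\<close>

lemma weighted_shift:
  assumes inj: "inj_on \<sigma> J" and J: "J \<subseteq> I" and \<sigma>: "\<sigma> ` J \<subseteq> I"
    and c: "\<And>i. i \<in> J \<Longrightarrow> cmod (c i) \<le> 1"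
  shows "\<exists>A\<in>cbounded. norm A \<le> 1 \<and> (\<forall>i\<in>I. blinfun_apply A (\<xi> i) = (if i \<in> J then c i *\<^sub>C \<xi> (\<sigma> i) else 0))"
proof -
  have "\<exists>M. clinear M \<and> (\<forall>i\<in>I. M (\<xi> i) = (if i \<in> J then c i *\<^sub>C \<xi> (\<sigma> i) else 0)) \<and>
      (\<forall>f. norm (M f) \<le> norm f * sqrt 1)"
  proof (rule synthesis[of 1])
    fix F :: "'i set" and b :: "'i \<Rightarrow> complex" assume F: "finite F" "F \<subseteq> I"
    have inj': "inj_on \<sigma> (F \<inter> J)" using inj by (rule inj_on_subset) simp
    have sub: "\<sigma> ` (F \<inter> J) \<subseteq> I" using \<sigma> by auto
    define d where "d k = (let i = the_inv_into (F \<inter> J) \<sigma> k in b i * c i)" for k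
    have d: "d (\<sigma> i) = b i * c i" if "i \<in> F \<inter> J" for i
      using the_inv_into_f_f[OF inj' that] by (simp add: d_def)
    have "(\<Sum>i\<in>F. b i *\<^sub>C (if i \<in> J then c i *\<^sub>C \<xi> (\<sigma> i) else 0))
        = (\<Sum>i\<in>F \<inter> J. (b i * c i) *\<^sub>C \<xi> (\<sigma> i))"
      by (rule sum.mono_neutral_cong_right) (use F in \<open>auto simp: scaleC_scaleC scaleC.zero_right\<close>)
    also have "\<dots> = (\<Sum>k\<in>\<sigma> ` (F \<inter> J). d k *\<^sub>C \<xi> k)"
      by (subst sum.reindex[OF inj']) (simp add: d)
    finally have "(norm (\<Sum>i\<in>F. b i *\<^sub>C (if i \<in> J then c i *\<^sub>C \<xi> (\<sigma> i) else 0)))\<^sup>2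
        = (\<Sum>k\<in>\<sigma> ` (F \<inter> J). (cmod (d k))\<^sup>2)"
      using F sub by (simp add: norm_sum_square)
    also have "\<dots> = (\<Sum>i\<in>F \<inter> J. (cmod (b i))\<^sup>2 * (cmod (c i))\<^sup>2)"
      by (subst sum.reindex[OF inj']) (simp add: d norm_mult power_mult_distrib)
    also have "\<dots> \<le> (\<Sum>i\<in>F \<inter> J. (cmod (b i))\<^sup>2 * 1)"
      by (intro sum_mono mult_left_mono) (use c in \<open>auto simp: power_le_one\<close>)
    also have "\<dots> \<le> (\<Sum>i\<in>F. (cmod (b i))\<^sup>2)"
      using F by (simp add: sum_mono2)
    finally show "(norm (\<Sum>i\<in>F. b i *\<^sub>C (if i \<in> J then c i *\<^sub>C \<xi> (\<sigma> i) else 0)))\<^sup>2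
        \<le> 1 * (\<Sum>i\<in>F. (cmod (b i))\<^sup>2)" by simp
  qed simp
  then obtain M where M: "clinear M" "\<And>i. i \<in> I \<Longrightarrow> M (\<xi> i) = (if i \<in> J then c i *\<^sub>C \<xi> (\<sigma> i) else 0)"
      "\<And>f. norm (M f) \<le> norm f"
    by auto
  have ap: "blinfun_apply (Blinfun M) = M"
    using M(1) by (simp add: clinear_def bounded_linear_Blinfun_apply)
  show ?thesis
  proof (intro bexI[of _ "Blinfun M"] conjI)
    show "norm (Blinfun M) \<le> 1" by (rule norm_blinfun_bound) (simp_all add: ap M)
  qed (use M in \<open>auto simp: cbounded_def clinear_def ap\<close>)
qed

end

section \<open>Positive semidefinite forms\<close>

text \<open>
  The form \<open>[x, y] = \<langle>\<Delta> x, y\<rangle>\<close> plays the role of \<open>\<langle>\<Delta>\<^bsup>1/2\<^esup> x, \<Delta>\<^bsup>1/2\<^esup> y\<rangle>\<close>, so that no operator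
  square root has to be constructed.
\<close>

locale psd =
  fixes \<Delta> :: "'h::chilbert_space \<Rightarrow>\<^sub>L 'h"
  assumes pos: "positive_op \<Delta>"
begin

definition form :: "'h \<Rightarrow> 'h \<Rightarrow> complex" where "form x y = cinner (\<Delta> x) y"
definition quad :: "'h \<Rightarrow> real" where "quad x = Re (form x x)"

lemma \<Delta>_cbounded [simp, intro]: "\<Delta> \<in> cbounded" using pos by (simp add: positive_op_def)

lemma form_self: "form x x = of_real (quad x)" and quad_nonneg: "0 \<le> quad x"
proof -
  have "form x x \<in> \<real>\<^sub>\<ge>\<^sub>0" using pos by (simp add: positive_op_def form_def)
  then show "form x x = of_real (quad x)" "0 \<le> quad x"
    by (auto simp: quad_def complex_nonneg_Reals_iff complex_eq_iff)
qed

lemma form_add_left: "form (x + y) z = form x z + form y z"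
  and form_add_right: "form z (x + y) = form z x + form z y"
  and form_diff_left: "form (x - y) z = form x z - form y z"
  and form_diff_right: "form z (x - y) = form z x - form z y"
  and form_scaleC_left: "form (c *\<^sub>C x) z = c * form x z"
  and form_scaleC_right: "form z (c *\<^sub>C x) = cnj c * form z x"
  and form_sum_left: "form (sum f S) z = (\<Sum>i\<in>S. form (f i) z)"
  and form_sum_right: "form z (sum f S) = (\<Sum>i\<in>S. form z (f i))"
  by (simp_all add: form_def blinfun.add_right blinfun.diff_right blinfun.sum_right cbounded_scaleC
      cinner_add_left cinner_add_right cinner.diff_left cinner.diff_right cinner_scaleC_left
      cinner_scaleC_right cinner.sum_left cinner.sum_right)

lemma form_commute: "form y x = cnj (form x y)"
proof (rule complex_eqI)
  have real: "Im (form z z) = 0" for z by (simp add: form_self)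
  have "Im (form (x + y) (x + y)) = Im (form x y) + Im (form y x)"
    by (simp add: form_add_left form_add_right real)
  then show "Im (form y x) = Im (cnj (form x y))" by (simp add: real)
  have "Im (form (x + \<i> *\<^sub>C y) (x + \<i> *\<^sub>C y)) = Re (form y x) - Re (form x y)"
    by (simp add: form_add_left form_add_right form_scaleC_left form_scaleC_right real)
  then show "Re (form y x) = Re (cnj (form x y))" by (simp add: real)
qed

lemma quad_scaleC: "quad (c *\<^sub>C x) = (cmod c)\<^sup>2 * quad x"
proof -
  have "form (c *\<^sub>C x) (c *\<^sub>C x) = of_real ((cmod c)\<^sup>2 * quad x)"
    unfolding form_scaleC_left form_scaleC_right of_real_mult complex_norm_square by (simp add: form_self)
  then show ?thesis by (simp add: quad_def)
qed

lemma form_Cauchy_Schwarz: "(cmod (form x y))\<^sup>2 \<le> quad x * quad y"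
proof -
  define Z where "Z = (cmod (form x y))\<^sup>2"
  have Z: "complex_of_real Z = form x y * cnj (form x y)" unfolding Z_def by (rule complex_norm_square)
  \<comment> \<open>\<open>quad (x - s [x, y] y)\<close> as a quadratic polynomial in the real number \<open>s\<close>\<close>
  have ineq: "0 \<le> quad x - 2 * s * Z + s\<^sup>2 * Z * quad y" for s
  proof -
    define t where "t = of_real s * form x y"
    have "form (x - t *\<^sub>C y) (x - t *\<^sub>C y)
        = form x x - 2 * of_real s * (form x y * cnj (form x y))
          + of_real (s\<^sup>2) * (form x y * cnj (form x y)) * form y y"
      unfolding form_diff_left form_diff_right form_scaleC_left form_scaleC_right
      by (simp add: t_def form_commute[of y x] power2_eq_square algebra_simps)
    also have "\<dots> = of_real (quad x - 2 * s * Z + s\<^sup>2 * Z * quad y)"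
      unfolding Z[symmetric] form_self by simp
    finally have "quad (x - t *\<^sub>C y) = quad x - 2 * s * Z + s\<^sup>2 * Z * quad y"
      by (simp only: quad_def Re_complex_of_real)
    then show ?thesis using quad_nonneg[of "x - t *\<^sub>C y"] by simp
  qed
  have "Z \<le> quad x * quad y"
  proof (cases "quad y = 0")
    case True
    have "Z = 0"
    proof (rule ccontr)
      assume "Z \<noteq> 0"
      then have "Z > 0" by (simp add: Z_def)
      then show False using ineq[of "(quad x + 1) / (2 * Z)"] quad_nonneg[of x] True by simp
    qed
    with True show ?thesis by simp
  next
    case False
    then have "quad y > 0" using quad_nonneg[of y] by simp
    then show ?thesis using ineq[of "1 / quad y"] by (simp add: field_simps power2_eq_square)
  qed
  then show ?thesis by (simp add: Z_def)
qed

lemma form_eq_0: "quad x = 0 \<Longrightarrow> form x y = 0"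
  using form_Cauchy_Schwarz[of x y] by simp

definition form_orthonormal :: "'h set \<Rightarrow> bool" where
  "form_orthonormal U \<longleftrightarrow> finite U \<and> (\<forall>u\<in>U. \<forall>v\<in>U. form u v = (if u = v then 1 else 0))"

lemma form_orthonormal_coefficient:
  assumes "form_orthonormal U" "v \<in> U"
  shows "form (\<Sum>u\<in>U. c u *\<^sub>C u) v = c v"
proof -
  have "form (\<Sum>u\<in>U. c u *\<^sub>C u) v = (\<Sum>u\<in>U. if u = v then c v else 0)"
    unfolding form_sum_left
    by (intro sum.cong) (use assms in \<open>auto simp: form_orthonormal_def form_scaleC_left\<close>)
  then show ?thesis using assms by (simp add: form_orthonormal_def)
qed

lemma quad_sum_orthonormal:
  assumes U: "form_orthonormal U"
  shows "quad (\<Sum>u\<in>U. c u *\<^sub>C u) = (\<Sum>u\<in>U. (cmod (c u))\<^sup>2)"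
proof -
  let ?s = "\<Sum>u\<in>U. c u *\<^sub>C u"
  have "form ?s ?s = (\<Sum>v\<in>U. cnj (c v) * form ?s v)"
    by (simp add: form_sum_right form_scaleC_right)
  also have "\<dots> = (\<Sum>v\<in>U. cnj (c v) * c v)"
    by (intro sum.cong refl) (simp add: form_orthonormal_coefficient[OF U])
  also have "\<dots> = of_real (\<Sum>u\<in>U. (cmod (c u))\<^sup>2)"
    unfolding of_real_sum complex_norm_square by (simp add: mult.commute)
  finally show ?thesis by (simp only: quad_def Re_complex_of_real)
qed

lemma form_bessel:
  assumes U: "form_orthonormal U"
  shows "(\<Sum>u\<in>U. (cmod (form x u))\<^sup>2) \<le> quad x"
proof -
  let ?s = "\<Sum>u\<in>U. form x u *\<^sub>C u"
  let ?n = "\<Sum>u\<in>U. (cmod (form x u))\<^sup>2"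
  have xs: "form x ?s = of_real ?n"
    unfolding form_sum_right form_scaleC_right of_real_sum complex_norm_square
    by (simp add: mult.commute)
  have "form (x - ?s) (x - ?s) = form x x - form x ?s - cnj (form x ?s) + form ?s ?s"
    unfolding form_diff_left form_diff_right by (subst form_commute[of ?s x]) simp
  also have "\<dots> = of_real (quad x - ?n)"
    unfolding xs form_self quad_sum_orthonormal[OF U] by simp
  finally have "quad (x - ?s) = quad x - ?n" by (simp only: quad_def Re_complex_of_real)
  then show ?thesis using quad_nonneg[of "x - ?s"] by simp
qed

text \<open>
  Parseval's identity for \<open>x\<close>: modulo the kernel of the form, \<open>x\<close> lies in the span of the
  orthonormal set \<open>U\<close>.
\<close>

definition captures :: "'h set \<Rightarrow> 'h \<Rightarrow> bool" where
  "captures U x \<longleftrightarrow> (\<forall>y. form x y = (\<Sum>u\<in>U. form x u * form u y))"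

text \<open>
  Orthonormalization with respect to a degenerate form: a remainder of seminorm zero
  contributes nothing to any value of the form and is dropped.
\<close>

lemma gram_schmidt:
  assumes "finite X"
  shows "\<exists>U. form_orthonormal U \<and> (\<forall>x\<in>X. captures U x)"
  using assms
proof (induction X)
  case empty
  show ?case by (intro exI[of _ "{}"]) (simp add: form_orthonormal_def)
next
  case (insert z X)
  then obtain U where U: "form_orthonormal U" and X: "\<And>x. x \<in> X \<Longrightarrow> captures U x" by blast
  define z' where "z' = z - (\<Sum>u\<in>U. form z u *\<^sub>C u)"
  have z': "form z y = (\<Sum>u\<in>U. form z u * form u y) + form z' y" for y
    by (simp add: z'_def form_diff_left form_sum_left form_scaleC_left)
  have z'U: "form z' u = 0" if "u \<in> U" for u
    using form_orthonormal_coefficient[OF U that, of "form z"] by (simp add: z'_def form_diff_left)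
  show ?case
  proof (cases "quad z' = 0")
    case True
    have "form z y = (\<Sum>u\<in>U. form z u * form u y)" for y
      using z'[of y] form_eq_0[OF True, of y] by simp
    then have "captures U z" unfolding captures_def by blast
    with U X show ?thesis by blast
  next
    case False
    then have q: "quad z' > 0" using quad_nonneg[of z'] by simp
    define r where "r = sqrt (quad z')"
    have r: "r > 0" "r * r = quad z'" using q by (simp_all add: r_def)
    define v where "v = of_real (1 / r) *\<^sub>C z'"
    have vy: "form v y = of_real (1 / r) * form z' y" for y by (simp add: v_def form_scaleC_left)
    have yv: "form y v = of_real (1 / r) * form y z'" for y by (simp add: v_def form_scaleC_right)
    have vu: "form v u = 0" "form u v = 0" if "u \<in> U" for u
      using z'U[OF that] form_commute[of u v] by (simp_all add: vy)
    have vv: "form v v = 1"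
      using r(1) by (simp add: vy yv form_self[of z'] r(2)[symmetric])
    have vnU: "v \<notin> U" using vu vv by auto
    have fin: "finite U" using U by (simp add: form_orthonormal_def)
    have on: "form_orthonormal (insert v U)"
      using U vu vv vnU unfolding form_orthonormal_def by auto
    have "captures (insert v U) x" if "x \<in> X" for x
    proof -
      have x: "form x y = (\<Sum>u\<in>U. form x u * form u y)" for y
        using X[OF that] unfolding captures_def by blast
      have "form x v = 0" by (subst x) (simp add: vu)
      then have "form x y = (\<Sum>u\<in>insert v U. form x u * form u y)" for y
        using x[of y] fin vnU by simp
      then show ?thesis unfolding captures_def by blast
    qed
    moreover have "captures (insert v U) z"
    proof -
      have "form z v * form v y = form z' y" for y
      proof -
        have "form z v = form z' v" using z'[of v] by (simp add: vu)
        also have "\<dots> = of_real r" using r(1) by (simp add: yv form_self[of z'] r(2)[symmetric])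
        finally show ?thesis using r(1) by (simp add: vy)
      qed
      then have "form z y = (\<Sum>u\<in>insert v U. form z u * form u y)" for y
        using z'[of y] fin vnU by simp
      then show ?thesis unfolding captures_def by blast
    qed
    ultimately show ?thesis using on by blast
  qed
qed

text \<open>
  Vectors that the form does not distinguish have the same image under \<open>\<Delta>\<close>.
\<close>

lemma captures_expand:
  assumes "captures U x"
  shows "\<Delta> (\<Sum>u\<in>U. form x u *\<^sub>C u) = \<Delta> x"
proof (rule cinner_ext_left)
  fix y
  have "form x y = (\<Sum>u\<in>U. form x u * form u y)"
    using assms unfolding captures_def by blast
  then have "form (\<Sum>u\<in>U. form x u *\<^sub>C u) y = form x y"
    by (simp only: form_sum_left form_scaleC_left)
  then show "cinner (\<Delta> (\<Sum>u\<in>U. form x u *\<^sub>C u)) y = cinner (\<Delta> x) y"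
    by (simp add: form_def)
qed

text \<open>
  The row operator \<open>(z\<^sub>i) \<mapsto> \<Sum>\<^sub>i \<tau>\<^sub>i \<Delta> z\<^sub>i\<close> is the adjoint of \<open>g \<mapsto> (\<tau>\<^sub>i\<^sup>* g)\<close> with respect to
  the form \<open>[x, y]\<close>, so it has the same norm.
\<close>

lemma row_bound:
  assumes F: "finite F" and \<tau>: "\<And>i. i \<in> F \<Longrightarrow> \<tau> i \<in> cbounded" and C0: "0 \<le> C"
    and C: "\<And>g. (\<Sum>i\<in>F. quad (cadjoint (\<tau> i) g)) \<le> C * (norm g)\<^sup>2"
  shows "(norm (\<Sum>i\<in>F. \<tau> i (\<Delta> (z i))))\<^sup>2 \<le> C * (\<Sum>i\<in>F. quad (z i))"
proof -
  define s where "s = (\<Sum>i\<in>F. \<tau> i (\<Delta> (z i)))"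
  define a where "a i = blinfun_apply (cadjoint (\<tau> i)) s" for i
  have "complex_of_real ((norm s)\<^sup>2) = cinner s s" by (simp add: cinner_self)
  also have "\<dots> = (\<Sum>i\<in>F. form (z i) (a i))"
    unfolding a_def form_def
    by (subst (1) s_def) (simp add: cinner.sum_left cinner_cadjoint \<tau>)
  finally have "(norm s)\<^sup>2 = cmod (\<Sum>i\<in>F. form (z i) (a i))"
    by (metis abs_of_nonneg norm_of_real zero_le_power2)
  also have "\<dots> \<le> (\<Sum>i\<in>F. sqrt (quad (z i)) * sqrt (quad (a i)))"
  proof (rule sum_norm_le)
    fix i
    have "cmod (form (z i) (a i)) \<le> sqrt (quad (z i) * quad (a i))"
      by (rule real_le_rsqrt[OF form_Cauchy_Schwarz])
    then show "cmod (form (z i) (a i)) \<le> sqrt (quad (z i)) * sqrt (quad (a i))"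
      by (simp add: real_sqrt_mult)
  qed
  finally have "((norm s)\<^sup>2)\<^sup>2 \<le> (\<Sum>i\<in>F. sqrt (quad (z i)) * sqrt (quad (a i)))\<^sup>2"
    by (rule power_mono) simp
  also have "\<dots> \<le> (\<Sum>i\<in>F. (sqrt (quad (z i)))\<^sup>2) * (\<Sum>i\<in>F. (sqrt (quad (a i)))\<^sup>2)"
    by (rule Cauchy_Schwarz_ineq_sum)
  also have "\<dots> = (\<Sum>i\<in>F. quad (z i)) * (\<Sum>i\<in>F. quad (a i))"
    by (simp add: quad_nonneg)
  also have "\<dots> \<le> (\<Sum>i\<in>F. quad (z i)) * (C * (norm s)\<^sup>2)"
    using C[of s] by (intro mult_left_mono sum_nonneg quad_nonneg) (simp add: a_def)
  finally have *: "(norm s)\<^sup>2 * (norm s)\<^sup>2 \<le> (C * (\<Sum>i\<in>F. quad (z i))) * (norm s)\<^sup>2"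
    by (simp add: power2_eq_square mult_ac)
  show ?thesis
  proof (cases "s = 0")
    case False
    then have "(norm s)\<^sup>2 > 0" by simp
    then show ?thesis using * unfolding s_def[symmetric] by (metis mult_le_cancel_right_pos)
  next
    case True
    then show ?thesis
      unfolding s_def[symmetric] using C0 by (simp add: quad_nonneg sum_nonneg)
  qed
qed

end

section \<open>Resolutions of the identity\<close>

text \<open>
  The resolution identity says that \<open>K h = \<Sum>\<^sub>i \<xi>\<^sub>i \<otimes> \<Delta>\<^bsup>1/2\<^esup> \<tau>\<^sub>i\<^sup>* h\<close> is an isometry from \<open>\<H>\<close>
  into \<open>\<K> \<otimes> \<H>\<close>, where \<open>\<K>\<close> is the space of the basis \<open>\<xi>\<close>. The tensor product is never formed:
  the maps \<open>\<theta>\<^sub>k\<close> introduced below are the components \<open>f \<mapsto> K\<^sup>* (f \<otimes> \<Delta>\<^bsup>1/2\<^esup> k)\<close> of the adjoint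
  of \<open>K\<close>.
\<close>

locale frame = onb I \<xi> + psd \<Delta>
  for I :: "'i set" and \<xi> :: "'i \<Rightarrow> 'k::chilbert_space" and \<Delta> :: "'h::chilbert_space \<Rightarrow>\<^sub>L 'h" +
  fixes \<tau> :: "'i \<Rightarrow> ('h \<Rightarrow>\<^sub>L 'h)"
  assumes \<tau>: "i \<in> I \<Longrightarrow> \<tau> i \<in> cbounded"
    and resolution: "((\<lambda>i. quad (cadjoint (\<tau> i) h)) has_sum (norm h)\<^sup>2) I"
begin

lemma finite_resolution:
  assumes "finite F" "F \<subseteq> I"
  shows "(\<Sum>i\<in>F. quad (cadjoint (\<tau> i) h)) \<le> (norm h)\<^sup>2"
  using finite_sum_le_has_sum[OF resolution assms] quad_nonneg by simp

lemma frame_row_bound: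
  assumes "finite F" "F \<subseteq> I"
  shows "(norm (\<Sum>i\<in>F. \<tau> i (\<Delta> (z i))))\<^sup>2 \<le> (\<Sum>i\<in>F. quad (z i))"
  using row_bound[of F \<tau> 1 z] finite_resolution[OF assms] assms \<tau> by auto

text \<open>
  This is \<open>K\<^sup>* K = 1\<close>. The sum \<open>s\<close> satisfies \<open>\<langle>s, h\<rangle> = \<parallel>h\<parallel>\<^sup>2\<close> and \<open>\<parallel>s\<parallel> \<le> \<parallel>h\<parallel>\<close>, which forces
  \<open>s = h\<close>.
\<close>

lemma reconstruction:
  "((\<lambda>i. \<tau> i (\<Delta> (cadjoint (\<tau> i) h))) has_sum h) I"
proof -
  let ?t = "\<lambda>i. \<tau> i (\<Delta> (cadjoint (\<tau> i) h))"
  let ?q = "\<lambda>i. quad (cadjoint (\<tau> i) h)"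
  have "?t summable_on I" and le: "(norm (infsum ?t I))\<^sup>2 \<le> 1 * infsum ?q I"
    by (rule square_dominated_summable[where C = 1 and b = ?q];
        use frame_row_bound resolution quad_nonneg in \<open>auto intro: has_sum_imp_summable\<close>)+
  then obtain s where s: "(?t has_sum s) I" and s': "s = infsum ?t I" by (simp add: has_sum_infsum)
  have "((\<lambda>i. cinner (?t i) h) has_sum cinner s h) I"
    by (rule has_sum_bounded_linear[OF cinner.bounded_linear_left s])
  then have "((\<lambda>i. complex_of_real (?q i)) has_sum cinner s h) I"
    by (rule has_sum_cong[THEN iffD1, rotated])
       (simp add: cinner_cadjoint \<tau> form_self[symmetric] form_def)
  moreover have "((\<lambda>i. complex_of_real (?q i)) has_sum of_real ((norm h)\<^sup>2)) I"
    by (rule has_sum_of_real[OF resolution])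
  ultimately have "cinner s h = of_real ((norm h)\<^sup>2)" by (rule has_sum_unique)
  then have "Re (cinner s h) = (norm h)\<^sup>2" by (simp only: Re_complex_of_real)
  then have "inner s h = (norm h)\<^sup>2" by (simp only: Re_cinner)
  moreover have "infsum ?q I = (norm h)\<^sup>2" by (rule infsumI[OF resolution])
  moreover have "(norm (s - h))\<^sup>2 = (norm s)\<^sup>2 - 2 * inner s h + (norm h)\<^sup>2"
    by (simp add: power2_norm_eq_inner inner_diff inner_commute)
  ultimately have "(norm (s - h))\<^sup>2 \<le> 0" using le s' by simp
  then have "s = h" by simp
  with s show ?thesis by simp
qed

text \<open>
  An operator is determined by its values on the vectors \<open>\<tau>\<^sub>i \<Delta> k\<close>. This is how identities
  between values of the functional calculus are proved.
\<close>

lemma eq_on_generators: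
  fixes X Y :: "'h \<Rightarrow>\<^sub>L 'h"
  assumes "\<And>i k. i \<in> I \<Longrightarrow>
    blinfun_apply X (\<tau> i (\<Delta> k)) = blinfun_apply Y (\<tau> i (\<Delta> k))"
  shows "X = Y"
proof (rule blinfun_eqI, rule has_sum_unique)
  fix h
  let ?t = "\<lambda>i. \<tau> i (\<Delta> (cadjoint (\<tau> i) h))"
  show "((\<lambda>i. blinfun_apply X (?t i)) has_sum blinfun_apply X h) I"
    by (rule has_sum_bounded_linear[OF blinfun.bounded_linear_right reconstruction])
  have "((\<lambda>i. blinfun_apply Y (?t i)) has_sum blinfun_apply Y h) I"
    by (rule has_sum_bounded_linear[OF blinfun.bounded_linear_right reconstruction])
  then show "((\<lambda>i. blinfun_apply X (?t i)) has_sum blinfun_apply Y h) I"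
    by (rule has_sum_cong[THEN iffD1, rotated]) (simp add: assms)
qed

lemma generators_dense:
  "closure (span {\<tau> i (\<Delta> k) | i k. i \<in> I}) = UNIV" (is "closure (span ?D) = _")
proof -
  have "h \<in> closure (span ?D)" for h
  proof (rule Lim_in_closed_set)
    let ?t = "\<lambda>i. \<tau> i (\<Delta> (cadjoint (\<tau> i) h))"
    show "(sum ?t \<longlongrightarrow> h) (finite_subsets_at_top I)" using reconstruction by (simp add: has_sum_def)
    show "eventually (\<lambda>F. sum ?t F \<in> closure (span ?D)) (finite_subsets_at_top I)"
      by (intro eventually_finite_subsets_at_top_weakI closure_subset[THEN subsetD] span_sum span_base)
         blast
  qed auto
  then show ?thesis by blast
qed

lemma intertwiner_exists:
  "\<exists>M. clinear M \<and> (\<forall>i\<in>I. M (\<xi> i) = \<tau> i (\<Delta> k))"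
proof -
  have "\<exists>M. clinear M \<and> (\<forall>i\<in>I. M (\<xi> i) = \<tau> i (\<Delta> k)) \<and>
      (\<forall>f. norm (M f) \<le> norm f * sqrt (quad k))"
  proof (rule synthesis[OF quad_nonneg])
    fix F c assume F: "finite F" "F \<subseteq> I"
    have "(\<Sum>i\<in>F. c i *\<^sub>C \<tau> i (\<Delta> k))
        = (\<Sum>i\<in>F. \<tau> i (\<Delta> (c i *\<^sub>C k)))"
      by (intro sum.cong refl) (use F \<tau> in \<open>auto simp: cbounded_scaleC\<close>)
    then show "(norm (\<Sum>i\<in>F. c i *\<^sub>C \<tau> i (\<Delta> k)))\<^sup>2
        \<le> quad k * (\<Sum>i\<in>F. (cmod (c i))\<^sup>2)"
      using frame_row_bound[OF F, of "\<lambda>i. c i *\<^sub>C k"]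
      by (simp add: quad_scaleC sum_distrib_left mult.commute)
  qed
  then show ?thesis by blast
qed

definition \<theta> :: "'h \<Rightarrow> 'k \<Rightarrow> 'h" where
  "\<theta> k = (SOME M. clinear M \<and> (\<forall>i\<in>I. M (\<xi> i) = \<tau> i (\<Delta> k)))"

lemma \<theta>_clinear: "clinear (\<theta> k)"
  and \<theta>_basis: "i \<in> I \<Longrightarrow> \<theta> k (\<xi> i) = \<tau> i (\<Delta> k)"
  using someI_ex[OF intertwiner_exists[of k]] unfolding \<theta>_def[symmetric] by blast+

text \<open>
  The row \<open>(\<theta>\<^sub>u)\<close> over an orthonormal set \<open>U\<close> is a contraction, because it is \<open>K\<^sup>*\<close> restricted
  to the vectors \<open>\<Sum>\<^sub>u \<eta>\<^sub>u \<otimes> \<Delta>\<^bsup>1/2\<^esup> u\<close>.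
\<close>

lemma \<theta>_sum_bound:
  assumes U: "form_orthonormal U"
  shows "(norm (\<Sum>u\<in>U. \<theta> u (\<eta> u)))\<^sup>2 \<le> (\<Sum>u\<in>U. (norm (\<eta> u))\<^sup>2)"
proof -
  define z where "z i = (\<Sum>u\<in>U. cinner (\<eta> u) (\<xi> i) *\<^sub>C u)" for i
  have summand: "(\<Sum>u\<in>U. cinner (\<eta> u) (\<xi> i) *\<^sub>C \<theta> u (\<xi> i)) = \<tau> i (\<Delta> (z i))"
    if "i \<in> I" for i
    using that \<tau> by (simp add: z_def \<theta>_basis blinfun.sum_right cbounded_scaleC)
  have "((\<lambda>F. \<Sum>u\<in>U. \<Sum>i\<in>F. cinner (\<eta> u) (\<xi> i) *\<^sub>C \<theta> u (\<xi> i)) \<longlongrightarrow> (\<Sum>u\<in>U. \<theta> u (\<eta> u)))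
      (finite_subsets_at_top I)"
    by (intro tendsto_sum clinear_expansion[OF \<theta>_clinear, unfolded has_sum_def])
  then have "((\<lambda>F. (norm (\<Sum>u\<in>U. \<Sum>i\<in>F. cinner (\<eta> u) (\<xi> i) *\<^sub>C \<theta> u (\<xi> i)))\<^sup>2) \<longlongrightarrow>
      (norm (\<Sum>u\<in>U. \<theta> u (\<eta> u)))\<^sup>2) (finite_subsets_at_top I)"
    by (intro tendsto_power tendsto_norm)
  then show ?thesis
  proof (rule tendsto_upperbound)
    show "eventually (\<lambda>F. (norm (\<Sum>u\<in>U. \<Sum>i\<in>F. cinner (\<eta> u) (\<xi> i) *\<^sub>C \<theta> u (\<xi> i)))\<^sup>2
        \<le> (\<Sum>u\<in>U. (norm (\<eta> u))\<^sup>2)) (finite_subsets_at_top I)"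
    proof (rule eventually_finite_subsets_at_top_weakI)
      fix F assume F: "finite F" "F \<subseteq> I"
      have "(\<Sum>u\<in>U. \<Sum>i\<in>F. cinner (\<eta> u) (\<xi> i) *\<^sub>C \<theta> u (\<xi> i))
          = (\<Sum>i\<in>F. \<tau> i (\<Delta> (z i)))"
        by (subst sum.swap, intro sum.cong refl summand) (use F in blast)
      then have "(norm (\<Sum>u\<in>U. \<Sum>i\<in>F. cinner (\<eta> u) (\<xi> i) *\<^sub>C \<theta> u (\<xi> i)))\<^sup>2
          \<le> (\<Sum>i\<in>F. quad (z i))"
        using frame_row_bound[OF F] by simp
      also have "\<dots> = (\<Sum>u\<in>U. \<Sum>i\<in>F. (cmod (cinner (\<eta> u) (\<xi> i)))\<^sup>2)"
        unfolding z_def quad_sum_orthonormal[OF U] by (rule sum.swap)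
      also have "\<dots> \<le> (\<Sum>u\<in>U. (norm (\<eta> u))\<^sup>2)"
        by (intro sum_mono bessel F)
      finally show "(norm (\<Sum>u\<in>U. \<Sum>i\<in>F. cinner (\<eta> u) (\<xi> i) *\<^sub>C \<theta> u (\<xi> i)))\<^sup>2
          \<le> (\<Sum>u\<in>U. (norm (\<eta> u))\<^sup>2)" .
    qed
  qed simp
qed

lemma intertwined_on_basis:
  assumes "X \<in> cbounded" "A \<in> cbounded"
    and "\<And>i. i \<in> I \<Longrightarrow> blinfun_apply X (\<theta> k (\<xi> i)) = \<theta> k (blinfun_apply A (\<xi> i))"
  shows "blinfun_apply X (\<theta> k f) = \<theta> k (blinfun_apply A f)"
  by (rule clinear_eqI) (use assms in \<open>auto intro: clinear_compose \<theta>_clinear clinear_cbounded\<close>)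

text \<open>
  If \<open>X \<theta>\<^sub>k = \<theta>\<^sub>k A\<close> for all \<open>k\<close>, then \<open>X\<close> is the compression of \<open>A \<otimes> 1\<close> by \<open>K\<close>, and so
  \<open>\<parallel>X\<parallel> \<le> \<parallel>A\<parallel>\<close>. In coordinates: a finite part of the reconstruction of \<open>h\<close> has the form
  \<open>\<Sum>\<^sub>u \<theta>\<^sub>u f\<^sub>u\<close> with \<open>u\<close> in a finite orthonormal set and \<open>\<Sum>\<^sub>u \<parallel>f\<^sub>u\<parallel>\<^sup>2 \<le> \<parallel>h\<parallel>\<^sup>2\<close>; the operator
  \<open>X\<close> turns it into \<open>\<Sum>\<^sub>u \<theta>\<^sub>u A f\<^sub>u\<close>, and the row of the \<open>\<theta>\<^sub>u\<close> is a contraction.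
\<close>

lemma intertwined_norm_le:
  assumes X: "X \<in> cbounded" and A: "A \<in> cbounded"
    and inter: "\<And>k i. i \<in> I \<Longrightarrow> blinfun_apply X (\<theta> k (\<xi> i)) = \<theta> k (blinfun_apply A (\<xi> i))"
  shows "norm X \<le> norm A"
proof (rule norm_blinfun_bound)
  fix h
  let ?t = "\<lambda>i. \<tau> i (\<Delta> (cadjoint (\<tau> i) h))"
  have "((\<lambda>F. norm (blinfun_apply X (sum ?t F))) \<longlongrightarrow> norm (blinfun_apply X h)) (finite_subsets_at_top I)"
    using reconstruction unfolding has_sum_def
    by (intro tendsto_norm blinfun.tendsto tendsto_const)
  then show "norm (blinfun_apply X h) \<le> norm A * norm h"
  proof (rule tendsto_upperbound)
    show "eventually (\<lambda>F. norm (blinfun_apply X (sum ?t F)) \<le> norm A * norm h) (finite_subsets_at_top I)"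
    proof (rule eventually_finite_subsets_at_top_weakI)
      fix F assume F: "finite F" "F \<subseteq> I"
      define x where "x i = blinfun_apply (cadjoint (\<tau> i)) h" for i
      obtain U where U: "form_orthonormal U" and cap: "\<And>i. i \<in> F \<Longrightarrow> captures U (x i)"
        using gram_schmidt[of "x ` F"] F by blast
      define f where "f u = (\<Sum>i\<in>F. form (x i) u *\<^sub>C \<xi> i)" for u
      have \<theta>f: "\<theta> u (f u) = (\<Sum>i\<in>F. form (x i) u *\<^sub>C \<tau> i (\<Delta> u))" for u
      proof -
        have "\<theta> u (f u) = (\<Sum>i\<in>F. \<theta> u (form (x i) u *\<^sub>C \<xi> i))"
          unfolding f_def using \<theta>_clinear[of u] by (simp add: clinear_def linear_sum bounded_linear.linear)
        also have "\<dots> = (\<Sum>i\<in>F. form (x i) u *\<^sub>C \<tau> i (\<Delta> u))"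
          using F \<theta>_clinear[of u] by (intro sum.cong) (auto simp: \<theta>_basis clinear_def)
        finally show ?thesis .
      qed
      have "sum ?t F = (\<Sum>i\<in>F. \<tau> i (\<Delta> (\<Sum>u\<in>U. form (x i) u *\<^sub>C u)))"
        by (intro sum.cong refl) (simp add: captures_expand[OF cap] x_def[symmetric])
      also have "\<dots> = (\<Sum>i\<in>F. \<Sum>u\<in>U. form (x i) u *\<^sub>C \<tau> i (\<Delta> u))"
        using F \<tau> by (intro sum.cong refl) (auto simp: blinfun.sum_right cbounded_scaleC subset_iff)
      also have "\<dots> = (\<Sum>u\<in>U. \<theta> u (f u))" unfolding \<theta>f by (rule sum.swap)
      finally have "blinfun_apply X (sum ?t F) = (\<Sum>u\<in>U. \<theta> u (blinfun_apply A (f u)))"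
        by (simp add: blinfun.sum_right intertwined_on_basis[OF X A inter])
      then have "(norm (blinfun_apply X (sum ?t F)))\<^sup>2 \<le> (\<Sum>u\<in>U. (norm (blinfun_apply A (f u)))\<^sup>2)"
        using \<theta>_sum_bound[OF U] by simp
      also have "\<dots> \<le> (\<Sum>u\<in>U. (norm A)\<^sup>2 * (norm (f u))\<^sup>2)"
        by (intro sum_mono) (metis norm_blinfun norm_ge_zero power_mono power_mult_distrib)
      also have "\<dots> = (norm A)\<^sup>2 * (\<Sum>i\<in>F. \<Sum>u\<in>U. (cmod (form (x i) u))\<^sup>2)"
        unfolding f_def norm_sum_square[OF F] sum_distrib_left[symmetric] by (subst sum.swap) simp
      also have "\<dots> \<le> (norm A)\<^sup>2 * (\<Sum>i\<in>F. quad (x i))"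
        by (intro mult_left_mono sum_mono form_bessel U) simp
      also have "\<dots> \<le> (norm A)\<^sup>2 * (norm h)\<^sup>2"
        unfolding x_def by (intro mult_left_mono finite_resolution F) simp
      finally have "(norm (blinfun_apply X (sum ?t F)))\<^sup>2 \<le> (norm A * norm h)\<^sup>2"
        by (simp add: power_mult_distrib)
      then show "norm (blinfun_apply X (sum ?t F)) \<le> norm A * norm h"
        by (rule power2_le_imp_le) simp
    qed
  qed simp
qed simp

end

section \<open>The free semigroupoid\<close>

text \<open>
  The product \<open>w z\<close>, in which \<open>z\<close> is traversed first.
\<close>

definition path_concat :: "('v, 'e) fpath \<Rightarrow> ('v, 'e) fpath \<Rightarrow> ('v, 'e) fpath" where
  "path_concat w z = (fst z, snd z @ snd w)"

context wf_digraph
begin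

lemma path_range_Nil [simp]: "path_range G (u, []) = u"
  by (simp add: path_range_def)

lemma path_range_Cons [simp]: "path_range G (u, e # p) = path_range G (head G e, p)"
  by (simp add: path_range_def)

lemma path_range_append: "path_range G (u, p @ q) = path_range G (path_range G (u, p), q)"
  by (simp add: path_range_def awlast_append)

lemma path_range_snoc [simp]: "path_range G (u, p @ [e]) = head G e"
  by (simp add: path_range_append)

lemma mem_free_semigroupoid: "(u, p) \<in> free_semigroupoid G \<longleftrightarrow> awalk u p (path_range G (u, p))"
  by (auto simp: free_semigroupoid_def path_range_def)

lemma free_semigroupoid_Nil [simp]: "(u, []) \<in> free_semigroupoid G \<longleftrightarrow> u \<in> verts G"
  by (simp add: mem_free_semigroupoid awalk_Nil_iff)

lemma free_semigroupoid_Cons [simp]: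
  "(u, e # p) \<in> free_semigroupoid G \<longleftrightarrow> e \<in> arcs G \<and> u = tail G e \<and> (head G e, p) \<in> free_semigroupoid G"
  by (simp add: mem_free_semigroupoid awalk_Cons_iff)

lemma free_semigroupoid_append:
  "(u, p @ q) \<in> free_semigroupoid G \<longleftrightarrow>
    (u, p) \<in> free_semigroupoid G \<and> (path_range G (u, p), q) \<in> free_semigroupoid G"
  by (simp add: mem_free_semigroupoid path_range_def awlast_append)

lemma free_semigroupoid_snoc [simp]:
  "(u, p @ [e]) \<in> free_semigroupoid G \<longleftrightarrow>
    (u, p) \<in> free_semigroupoid G \<and> e \<in> arcs G \<and> tail G e = path_range G (u, p)"
  by (auto simp: free_semigroupoid_append)

lemma source_in_verts: "w \<in> free_semigroupoid G \<Longrightarrow> fst w \<in> verts G"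
  and range_in_verts: "w \<in> free_semigroupoid G \<Longrightarrow> path_range G w \<in> verts G"
  by (cases w; auto simp: mem_free_semigroupoid)+

lemma path_concat_in:
  assumes "w \<in> free_semigroupoid G" "z \<in> free_semigroupoid G" "fst w = path_range G z"
  shows "path_concat w z \<in> free_semigroupoid G" and "path_range G (path_concat w z) = path_range G w"
  using assms by (cases w; cases z; simp add: path_concat_def free_semigroupoid_append path_range_append)+

lemma extend_path_in:
  assumes "w \<in> free_semigroupoid G" "e \<in> arcs G" "path_range G w = tail G e"
  shows "extend_path e w \<in> free_semigroupoid G" and "path_range G (extend_path e w) = head G e"
  using assms by (cases w; simp add: extend_path_def)+

end

section \<open>Operators attached to paths\<close>

text \<open>
  The limit \<open>S\<close> of the series \<open>\<Sum>\<^sub>e T\<^sub>e T\<^sub>e\<^sup>*\<close> is a parameter because the defect operators of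
  all the scaled row contractions \<open>r T\<close> are expressed in it.
\<close>

locale stabilized_row = wf_digraph G
  for G :: "('v, 'e) pre_digraph" +
  fixes T :: "'e \<Rightarrow> ('h::chilbert_space \<Rightarrow>\<^sub>L 'h)" and P :: "'v \<Rightarrow> ('h \<Rightarrow>\<^sub>L 'h)" and S :: "'h \<Rightarrow>\<^sub>L 'h"
  assumes T_cbounded [simp]: "e \<in> arcs G \<Longrightarrow> T e \<in> cbounded"
    and S_cbounded [simp]: "S \<in> cbounded"
    and S_sum: "((\<lambda>e. (T e o\<^sub>L cadjoint (T e)) h) has_sum S h) (arcs G)"
    and S_le: "op_le S id_blinfun"
    and stabilized: "stabilized_by G T P"
begin

abbreviation paths :: "('v, 'e) fpath set" where "paths \<equiv> free_semigroupoid G"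
abbreviation rng :: "('v, 'e) fpath \<Rightarrow> 'v" where "rng \<equiv> path_range G"

lemma P_projection: "x \<in> verts G \<Longrightarrow> is_projection (P x)"
  using stabilized by (simp add: stabilized_by_def)

lemma P_cbounded [simp]: "x \<in> verts G \<Longrightarrow> P x \<in> cbounded"
  and P_selfadjoint: "x \<in> verts G \<Longrightarrow> cadjoint (P x) = P x"
  using P_projection by (simp_all add: is_projection_def)

lemma P_P: "x \<in> verts G \<Longrightarrow> y \<in> verts G \<Longrightarrow> P x (P y h) = (if x = y then P x h else 0)"
proof -
  assume *: "x \<in> verts G" "y \<in> verts G"
  have "P x o\<^sub>L P y = (if x = y then P x else 0)"
    using * P_projection[of x] stabilized by (auto simp: is_projection_def stabilized_by_def)
  then show ?thesis by (metis blinfun_apply_blinfun_compose zero_blinfun.rep_eq)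
qed

lemma T_decomp: "e \<in> arcs G \<Longrightarrow> T e h = P (head G e) (T e (P (tail G e) h))"
  using stabilized unfolding stabilized_by_def by (metis blinfun_apply_blinfun_compose)

lemma P_T: "e \<in> arcs G \<Longrightarrow> x \<in> verts G \<Longrightarrow> P x (T e h) = (if x = head G e then T e h else 0)"
  using T_decomp[of e h] P_P[of x "head G e"] P_P[of "head G e" "head G e"] by auto

lemma T_P: "e \<in> arcs G \<Longrightarrow> x \<in> verts G \<Longrightarrow> T e (P x h) = (if x = tail G e then T e h else 0)"
  using T_decomp[of e "P x h"] T_decomp[of e h] P_P[of "tail G e" x h] by auto

lemma P_sum: "((\<lambda>x. P x h) has_sum h) (verts G)"
  using stabilized by (simp add: stabilized_by_def)

lemma P_norm_sum: "((\<lambda>x. (norm (P x h))\<^sup>2) has_sum (norm h)\<^sup>2) (verts G)"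
proof -
  have "((\<lambda>x. inner (P x h) h) has_sum inner h h) (verts G)"
    by (rule has_sum_bounded_linear[OF bounded_linear_inner_left P_sum])
  moreover have "inner (P x h) h = (norm (P x h))\<^sup>2" if x: "x \<in> verts G" for x
  proof -
    have "cinner (P x h) h = cinner (P x (P x h)) h" using x by (simp add: P_P)
    also have "\<dots> = cinner (P x h) (P x h)" using cinner_cadjoint[of "P x" "P x h" h] x
      by (simp add: P_selfadjoint)
    finally have "Re (cinner (P x h) h) = Re (cinner (P x h) (P x h))" by simp
    then show ?thesis by (simp add: Re_cinner power2_norm_eq_inner)
  qed
  ultimately show ?thesis
    unfolding power2_norm_eq_inner[of h] by (simp cong: has_sum_cong)
qed

text \<open>
  Multiplying by the projection at the source extends \<open>w \<mapsto> w(T)\<close> to vertices and makes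
  products of non-composable paths vanish.
\<close>

definition Tp :: "('v, 'e) fpath \<Rightarrow> ('h \<Rightarrow>\<^sub>L 'h)" where "Tp w = path_op T w o\<^sub>L P (fst w)"

lemma Tp_Nil [simp]: "Tp (x, []) h = P x h"
  by (simp add: Tp_def path_op_def)

lemma Tp_snoc [simp]: "Tp (x, p @ [e]) h = T e (Tp (x, p) h)"
  by (simp add: Tp_def path_op_def)

lemma Tp_cbounded [simp]: "w \<in> paths \<Longrightarrow> Tp w \<in> cbounded"
proof (induction "snd w" arbitrary: w rule: rev_induct)
  case Nil
  then have "Tp w = P (fst w)" by (intro blinfun_eqI) (simp add: Tp_def path_op_def)
  with Nil.prems show ?case by (simp add: source_in_verts)
next
  case (snoc e p)
  obtain x where w: "w = (x, p @ [e])" using snoc.hyps(2) by (metis prod.collapse)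
  have "Tp (x, p) \<in> cbounded" "T e \<in> cbounded" using snoc.hyps(1)[of "(x, p)"] snoc.prems w by auto
  moreover have "Tp w = T e o\<^sub>L Tp (x, p)" by (rule blinfun_eqI) (simp add: w)
  ultimately show ?case by simp
qed

lemma P_Tp: "x \<in> verts G \<Longrightarrow> z \<in> paths \<Longrightarrow> P x (Tp z h) = (if x = rng z then Tp z h else 0)"
proof (cases "snd z" rule: rev_cases)
  case Nil
  assume "x \<in> verts G" "z \<in> paths"
  with Nil show ?thesis by (cases z) (simp add: P_P)
next
  case (snoc p e)
  assume "x \<in> verts G" "z \<in> paths"
  with snoc show ?thesis by (cases z) (simp add: P_T)
qed

lemma T_Tp:
  assumes "e \<in> arcs G" "z \<in> paths"
  shows "T e (Tp z h) = (if rng z = tail G e then Tp (extend_path e z) h else 0)"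
proof -
  have "T e (Tp z h) = T e (P (tail G e) (Tp z h))" using assms by (simp add: T_P)
  also have "\<dots> = (if rng z = tail G e then T e (Tp z h) else 0)" using assms by (simp add: P_Tp)
  also have "\<dots> = (if rng z = tail G e then Tp (extend_path e z) h else 0)"
    by (cases z) (simp add: extend_path_def)
  finally show ?thesis .
qed

lemma Tp_Tp:
  assumes "w \<in> paths" "z \<in> paths"
  shows "Tp w (Tp z h) = (if fst w = rng z then Tp (path_concat w z) h else 0)"
  using assms(1)
proof (induction "snd w" arbitrary: w rule: rev_induct)
  case Nil
  then obtain x where w: "w = (x, [])" by (metis prod.collapse)
  with Nil.prems assms(2) show ?case by (simp add: P_Tp path_concat_def)
next
  case (snoc e p)
  obtain x where w: "w = (x, p @ [e])" using snoc.hyps(2) by (metis prod.collapse)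
  have IH: "Tp (x, p) (Tp z h) = (if x = rng z then Tp (fst z, snd z @ p) h else 0)"
    using snoc.hyps(1)[of "(x, p)"] snoc.prems w by (simp add: path_concat_def)
  then show ?case
    using Tp_snoc[of "fst z" "snd z @ p" e h] by (simp add: w path_concat_def blinfun.zero_right)
qed

lemma Tp_P:
  assumes "w \<in> paths" "x \<in> verts G"
  shows "Tp w (P x h) = (if fst w = x then Tp w h else 0)"
  using Tp_Tp[OF assms(1), of "(x, [])" h] assms(2) by (cases w) (simp add: path_concat_def)

lemma Tp_T:
  assumes "w \<in> paths" "e \<in> arcs G"
  shows "Tp w (T e h) = (if fst w = head G e then Tp (tail G e, e # snd w) h else 0)"
proof -
  have "T e h = Tp (tail G e, [e]) h"
    using Tp_snoc[of "tail G e" "[]" e h] T_P[of e "tail G e" h] assms by simp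
  then show ?thesis using Tp_Tp[OF assms(1), of "(tail G e, [e])" h] assms by (simp add: path_concat_def)
qed

lemma Tp_eq_path_op:
  assumes "w \<in> paths" "snd w \<noteq> []"
  shows "Tp w = path_op T w"
proof -
  obtain e p where w: "w = (tail G e, e # p)" and e: "e \<in> arcs G"
    using assms by (cases w; cases "snd w") auto
  have fold: "fold (\<lambda>e A. T e o\<^sub>L A) p B = fold (\<lambda>e A. T e o\<^sub>L A) p id_blinfun o\<^sub>L B" for B
    by (induction p arbitrary: B rule: rev_induct) (auto intro!: blinfun_eqI)
  have "path_op T w h = path_op T w (P (tail G e) h)" for h
    unfolding path_op_def w using e by (simp, subst (1 2) fold) (simp add: T_P)
  then show ?thesis by (intro blinfun_eqI) (simp add: Tp_def w)
qed

section \<open>Energy carried by the paths of a given length\<close>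

text \<open>
  This is \<open>\<parallel>T\<^sup>* h\<parallel>\<^sup>2 = \<Sum>\<^sub>e \<parallel>T\<^sub>e\<^sup>* h\<parallel>\<^sup>2\<close>, where \<open>T\<close> is regarded as a row operator.
\<close>

definition row_energy :: "'h \<Rightarrow> real" where "row_energy h = Re (cinner (S h) h)"

lemma row_energy_sum: "((\<lambda>e. (norm (cadjoint (T e) h))\<^sup>2) has_sum row_energy h) (arcs G)"
proof -
  have "((\<lambda>e. inner ((T e o\<^sub>L cadjoint (T e)) h) h) has_sum inner (S h) h) (arcs G)"
    by (rule has_sum_bounded_linear[OF bounded_linear_inner_left S_sum])
  moreover have "inner ((T e o\<^sub>L cadjoint (T e)) h) h = (norm (cadjoint (T e) h))\<^sup>2" if "e \<in> arcs G" for e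
    using cinner_cadjoint[OF T_cbounded[OF that], of "cadjoint (T e) h" h]
    by (simp add: Re_cinner[symmetric] cinner_self)
  ultimately show ?thesis unfolding row_energy_def Re_cinner by (simp cong: has_sum_cong)
qed

lemma row_energy_nonneg: "0 \<le> row_energy h"
  by (rule has_sum_nonneg[OF row_energy_sum]) simp

lemma row_energy_le: "row_energy h \<le> (norm h)\<^sup>2"
proof -
  have "cinner ((id_blinfun - S) h) h \<in> \<real>\<^sub>\<ge>\<^sub>0" using S_le by (simp add: op_le_def positive_op_def)
  then have "0 \<le> Re (cinner h h - cinner (S h) h)"
    by (simp add: complex_nonneg_Reals_iff blinfun.diff_left cinner.diff_left)
  then show ?thesis by (simp add: row_energy_def cinner_self)
qed

definition energy :: "nat \<Rightarrow> 'h \<Rightarrow> real" where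
  "energy d h = (\<Sum>\<^sub>\<infinity>w\<in>paths_of_length G d. (norm (cadjoint (Tp w) h))\<^sup>2)"

lemma adjoint_Tp_Cons:
  assumes "w \<in> paths" "e \<in> arcs G"
  shows "cadjoint (T e) (cadjoint (Tp w) h)
    = (if fst w = head G e then cadjoint (Tp (tail G e, e # snd w)) h else 0)"
proof -
  have "Tp w o\<^sub>L T e = (if fst w = head G e then Tp (tail G e, e # snd w) else 0)"
    by (rule blinfun_eqI) (simp add: Tp_T assms)
  moreover have "cadjoint (0 :: 'h \<Rightarrow>\<^sub>L 'h) = 0"
    by (rule cadjoint_eqI) (simp_all add: cinner.zero_left cinner.zero_right)
  moreover have "cadjoint (T e) (cadjoint (Tp w) h) = cadjoint (Tp w o\<^sub>L T e) h"
    using assms by (simp add: cadjoint_comp)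
  ultimately show ?thesis by simp
qed

text \<open>
  A path of length \<open>d + 1\<close> is a path \<open>w\<close> of length \<open>d\<close> together with a first edge \<open>e\<close> that
  ends at the source of \<open>w\<close>, and \<open>(w e)(T)\<^sup>* = T\<^sub>e\<^sup>* w(T)\<^sup>*\<close>; for all other pairs
  \<open>T\<^sub>e\<^sup>* w(T)\<^sup>*\<close> vanishes. So summing \<open>\<parallel>T\<^sub>e\<^sup>* w(T)\<^sup>* h\<parallel>\<^sup>2\<close> over \<open>e\<close> and then over \<open>w\<close> gives
  the energy at length \<open>d + 1\<close>.
\<close>

lemma energy_step:
  assumes "((\<lambda>w. (norm (cadjoint (Tp w) h))\<^sup>2) has_sum Q) (paths_of_length G d)"
  shows "\<exists>Q'. ((\<lambda>w. row_energy (cadjoint (Tp w) h)) has_sum Q') (paths_of_length G d) \<and>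
    ((\<lambda>w. (norm (cadjoint (Tp w) h))\<^sup>2) has_sum Q') (paths_of_length G (Suc d))"
proof -
  let ?W = "paths_of_length G d"
  have "(\<lambda>w. row_energy (cadjoint (Tp w) h)) summable_on ?W"
    by (rule summable_on_comparison_test[OF has_sum_imp_summable[OF assms]]) (simp_all add: row_energy_le row_energy_nonneg)
  then obtain Q' where Q': "((\<lambda>w. row_energy (cadjoint (Tp w) h)) has_sum Q') ?W"
    unfolding summable_on_def by blast
  define f where "f = (\<lambda>(w, e). (norm (cadjoint (T e) (cadjoint (Tp w) h)))\<^sup>2)"
  have inner: "((\<lambda>e. f (w, e)) has_sum row_energy (cadjoint (Tp w) h)) (arcs G)" for w
    unfolding f_def using row_energy_sum by simp
  have "f summable_on Sigma ?W (\<lambda>_. arcs G)"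
    by (rule summable_on_SigmaI[OF inner has_sum_imp_summable[OF Q']]) (simp add: f_def)
  then have "(f has_sum Q') (Sigma ?W (\<lambda>_. arcs G))"
    by (rule has_sum_SigmaI[OF inner Q'])
  moreover define J where "J = {(w, e). w \<in> ?W \<and> e \<in> arcs G \<and> fst w = head G e}"
  moreover have "(f has_sum Q') (Sigma ?W (\<lambda>_. arcs G)) \<longleftrightarrow> (f has_sum Q') J"
    by (rule has_sum_cong_neutral) (auto simp: f_def J_def paths_of_length_def adjoint_Tp_Cons split: if_splits)
  ultimately have J_sum: "(f has_sum Q') J" by simp
  have "bij_betw (\<lambda>(w, e). (tail G e, e # snd w)) J (paths_of_length G (Suc d))"
  proof (rule bij_betwI[where g = "\<lambda>w. ((head G (hd (snd w)), tl (snd w)), hd (snd w))"])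
    show "(\<lambda>(w, e). (tail G e, e # snd w)) \<in> J \<rightarrow> paths_of_length G (Suc d)"
      by (auto simp: J_def paths_of_length_def)
    show "(\<lambda>w. ((head G (hd (snd w)), tl (snd w)), hd (snd w))) \<in> paths_of_length G (Suc d) \<rightarrow> J"
      by (auto simp: J_def paths_of_length_def length_Suc_conv)
  qed (auto simp: J_def paths_of_length_def length_Suc_conv)
  moreover have "f x = (norm (cadjoint (Tp (case x of (w, e) \<Rightarrow> (tail G e, e # snd w))) h))\<^sup>2"
    if "x \<in> J" for x
    using that by (auto simp: f_def J_def paths_of_length_def adjoint_Tp_Cons)
  ultimately have "((\<lambda>w. (norm (cadjoint (Tp w) h))\<^sup>2) has_sum Q') (paths_of_length G (Suc d))"
    using J_sum by (subst has_sum_reindex_bij_betw[symmetric]) (auto cong: has_sum_cong)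
  with Q' show ?thesis by blast
qed

lemma length_0_has_sum:
  "((\<lambda>w. (norm (cadjoint (Tp w) h))\<^sup>2) has_sum (norm h)\<^sup>2) (paths_of_length G 0)"
proof -
  have eq: "paths_of_length G 0 = (\<lambda>x. (x, [])) ` verts G"
    by (auto simp: paths_of_length_def)
  have Tp0: "Tp (x, []) = P x" for x by (rule blinfun_eqI) simp
  show ?thesis
    unfolding eq using P_norm_sum
    by (subst has_sum_reindex) (auto simp: inj_on_def o_def Tp0 P_selfadjoint cong: has_sum_cong)
qed

lemma energy_has_sum:
  "((\<lambda>w. (norm (cadjoint (Tp w) h))\<^sup>2) has_sum energy d h) (paths_of_length G d)"
proof -
  have "\<exists>Q. ((\<lambda>w. (norm (cadjoint (Tp w) h))\<^sup>2) has_sum Q) (paths_of_length G d)"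
  proof (induction d)
    case 0
    show ?case using length_0_has_sum by blast
  next
    case (Suc d)
    then show ?case using energy_step by blast
  qed
  then show ?thesis unfolding energy_def by (metis has_sum_imp_summable has_sum_infsum)
qed

lemma energy_0: "energy 0 h = (norm h)\<^sup>2"
  by (rule has_sum_unique[OF energy_has_sum length_0_has_sum])

lemma energy_Suc_has_sum:
  "((\<lambda>w. row_energy (cadjoint (Tp w) h)) has_sum energy (Suc d) h) (paths_of_length G d)"
  using energy_step[OF energy_has_sum, of h d] energy_has_sum[of h "Suc d"] has_sum_unique by blast

lemma energy_nonneg: "0 \<le> energy d h"
  by (rule has_sum_nonneg[OF energy_has_sum]) simp

lemma energy_le: "energy d h \<le> (norm h)\<^sup>2"
proof (induction d)
  case (Suc d)
  have "energy (Suc d) h \<le> energy d h"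
    by (rule has_sum_mono[OF energy_Suc_has_sum energy_has_sum]) (rule row_energy_le)
  with Suc show ?case by simp
qed (simp add: energy_0)


section \<open>Scaled row contractions and their resolutions of the identity\<close>

text \<open>
  The defect operator of the row contraction \<open>r T\<close>, whose path operators are the \<open>\<tau> r w\<close>.
\<close>

definition \<Delta> :: "real \<Rightarrow> ('h \<Rightarrow>\<^sub>L 'h)" where "\<Delta> r = id_blinfun - r\<^sup>2 *\<^sub>R S"

definition \<tau> :: "real \<Rightarrow> ('v, 'e) fpath \<Rightarrow> ('h \<Rightarrow>\<^sub>L 'h)" where
  "\<tau> r w = r ^ length (snd w) *\<^sub>R Tp w"

lemma \<tau>_apply: "\<tau> r w h = r ^ length (snd w) *\<^sub>R Tp w h"
  by (simp add: \<tau>_def blinfun.scaleR_left)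

lemma \<tau>_cbounded [simp]: "w \<in> paths \<Longrightarrow> \<tau> r w \<in> cbounded"
  by (simp add: \<tau>_def)

lemma cadjoint_\<tau>: "w \<in> paths \<Longrightarrow> cadjoint (\<tau> r w) h = r ^ length (snd w) *\<^sub>R cadjoint (Tp w) h"
  by (simp add: \<tau>_def cadjoint_scaleR blinfun.scaleR_left)

lemma \<tau>_\<tau>:
  assumes "w \<in> paths" "z \<in> paths"
  shows "\<tau> r w (\<tau> r z h) = (if fst w = rng z then \<tau> r (path_concat w z) h else 0)"
  using Tp_Tp[OF assms, of h]
  by (simp add: \<tau>_apply blinfun.scaleR_right path_concat_def power_add mult.commute)

lemma \<tau>_P:
  assumes "w \<in> paths" "x \<in> verts G"
  shows "\<tau> r w (P x h) = (if fst w = x then \<tau> r w h else 0)"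
  using Tp_P[OF assms, of h] by (simp add: \<tau>_apply)

lemma \<Delta>_apply: "\<Delta> r h = h - r\<^sup>2 *\<^sub>R S h"
  by (simp add: \<Delta>_def blinfun.diff_left blinfun.scaleR_left)

lemma Re_\<Delta>: "Re (cinner (\<Delta> r h) h) = (norm h)\<^sup>2 - r\<^sup>2 * row_energy h"
  by (simp add: \<Delta>_apply cinner.diff_left cinner.scaleR_left cinner_self row_energy_def)

lemma \<Delta>_positive:
  assumes "0 \<le> r" "r \<le> 1"
  shows "positive_op (\<Delta> r)"
  unfolding positive_op_def
proof (intro conjI allI)
  show "\<Delta> r \<in> cbounded" by (simp add: \<Delta>_def)
  fix h
  have "cinner ((id_blinfun - S) h) h \<in> \<real>\<^sub>\<ge>\<^sub>0" using S_le by (simp add: op_le_def positive_op_def)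
  then have "Im (cinner (S h) h) = 0"
    by (simp add: complex_nonneg_Reals_iff blinfun.diff_left cinner.diff_left cinner_self)
  then have "Im (cinner (\<Delta> r h) h) = 0"
    by (simp add: \<Delta>_apply cinner.diff_left cinner.scaleR_left cinner_self)
  moreover have "r\<^sup>2 * row_energy h \<le> 1 * (norm h)\<^sup>2"
    using assms row_energy_le[of h] row_energy_nonneg[of h] by (intro mult_mono) (auto simp: power_le_one)
  then have "0 \<le> Re (cinner (\<Delta> r h) h)" by (simp add: Re_\<Delta>)
  ultimately show "cinner (\<Delta> r h) h \<in> \<real>\<^sub>\<ge>\<^sub>0" by (simp add: complex_nonneg_Reals_iff)
qed

lemma quad_\<Delta>:
  assumes "0 \<le> r" "r \<le> 1"
  shows "psd.quad (\<Delta> r) h = (norm h)\<^sup>2 - r\<^sup>2 * row_energy h"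
proof -
  interpret psd "\<Delta> r" by (rule psd.intro[OF \<Delta>_positive[OF assms]])
  show ?thesis unfolding quad_def form_def by (rule Re_\<Delta>)
qed

text \<open>
  The paths of length \<open>d\<close> contribute \<open>r\<^bsup>2d\<^esup> E\<^sub>d - r\<^bsup>2(d+1)\<^esup> E\<^bsub>d+1\<^esub>\<close>, where \<open>E\<^sub>d\<close> is the energy
  at length \<open>d\<close>. The sum over all lengths telescopes to \<open>E\<^sub>0 = \<parallel>h\<parallel>\<^sup>2\<close>.
\<close>

lemma path_resolution:
  assumes r: "0 \<le> r" "r \<le> 1" and lim: "(\<lambda>d. r ^ (2 * d) * energy d h) \<longlonglongrightarrow> 0"
  shows "((\<lambda>w. psd.quad (\<Delta> r) (cadjoint (\<tau> r w) h)) has_sum (norm h)\<^sup>2) paths"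
proof -
  interpret psd "\<Delta> r" by (rule psd.intro[OF \<Delta>_positive[OF r]])
  let ?t = "\<lambda>w. psd.quad (\<Delta> r) (cadjoint (\<tau> r w) h)"
  define f where "f d = r ^ (2 * d) * energy d h" for d
  have level: "(?t has_sum (f d - f (Suc d))) (paths_of_length G d)" for d
  proof -
    have "((\<lambda>w. r ^ (2 * d) * (norm (cadjoint (Tp w) h))\<^sup>2 + (- (r ^ (2 * Suc d))) * row_energy (cadjoint (Tp w) h))
        has_sum (r ^ (2 * d) * energy d h + (- (r ^ (2 * Suc d))) * energy (Suc d) h)) (paths_of_length G d)"
      by (intro has_sum_add has_sum_cmult_right energy_has_sum energy_Suc_has_sum)
    moreover have "?t w = r ^ (2 * d) * (norm (cadjoint (Tp w) h))\<^sup>2 + (- (r ^ (2 * Suc d))) * row_energy (cadjoint (Tp w) h)"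
      if w: "w \<in> paths_of_length G d" for w
    proof -
      have row_energy_scale: "row_energy (c *\<^sub>R x) = c\<^sup>2 * row_energy x" for c x
        by (simp add: row_energy_def blinfun.scaleR_right cinner.scaleR_left cinner.scaleR_right power2_eq_square)
      have c2: "(r ^ d)\<^sup>2 = r ^ (2 * d)" by (metis mult.commute power_mult)
      show ?thesis
        using w unfolding paths_of_length_def
        by (simp add: quad_\<Delta>[OF r] cadjoint_\<tau> row_energy_scale c2 power_mult_distrib right_diff_distrib power2_eq_square[of r])
    qed
    moreover have f_eq: "f d - f (Suc d) = r ^ (2 * d) * energy d h + (- (r ^ (2 * Suc d))) * energy (Suc d) h"
      by (simp add: f_def)
    ultimately show ?thesis unfolding f_eq by (simp only: cong: has_sum_cong)
  qed
  have "(\<lambda>d. f d - f (Suc d)) sums (f 0 - 0)"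
    using lim unfolding f_def by (rule telescope_sums')
  then have "(\<lambda>d. f d - f (Suc d)) sums (norm h)\<^sup>2" by (simp add: f_def energy_0)
  then have total: "((\<lambda>d. f d - f (Suc d)) has_sum (norm h)\<^sup>2) UNIV"
    by (rule sums_nonneg_imp_has_sum) (rule has_sum_nonneg[OF level quad_nonneg])
  have inner: "((\<lambda>w. (\<lambda>(d, w). ?t w) (d, w)) has_sum (f d - f (Suc d))) (paths_of_length G d)" for d
    using level by simp
  have "(\<lambda>(d, w). ?t w) summable_on Sigma UNIV (paths_of_length G)"
    by (rule summable_on_SigmaI[OF inner has_sum_imp_summable[OF total]]) (simp add: quad_nonneg)
  then have "((\<lambda>(d, w). ?t w) has_sum (norm h)\<^sup>2) (Sigma UNIV (paths_of_length G))"
    by (rule has_sum_SigmaI[OF inner total])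
  moreover have "bij_betw snd (Sigma UNIV (paths_of_length G)) paths"
    by (rule bij_betwI[where g = "\<lambda>w. (length (snd w), w)"]) (auto simp: paths_of_length_def)
  ultimately show ?thesis
    by (subst has_sum_reindex_bij_betw[symmetric]) (simp_all add: case_prod_unfold)
qed

lemma frame_scaled:
  assumes r: "0 \<le> r" "r < 1" and \<xi>: "orthonormal_basis_on paths \<xi>"
  shows "frame paths \<xi> (\<Delta> r) (\<tau> r)"
proof (intro frame.intro frame_axioms.intro onb.intro psd.intro \<xi> \<Delta>_positive \<tau>_cbounded path_resolution)
  fix h :: 'h
  have r2: "r\<^sup>2 < 1" using r by (simp add: power_less_one_iff abs_square_less_1)
  have "(\<lambda>d. (r\<^sup>2) ^ d * (norm h)\<^sup>2) \<longlonglongrightarrow> 0 * (norm h)\<^sup>2"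
    by (intro tendsto_mult tendsto_const LIMSEQ_realpow_zero) (use r2 in auto)
  then have lim: "(\<lambda>d. (r\<^sup>2) ^ d * (norm h)\<^sup>2) \<longlonglongrightarrow> 0" by simp
  show "(\<lambda>d. r ^ (2 * d) * energy d h) \<longlonglongrightarrow> 0"
  proof (rule tendsto_sandwich[OF _ _ tendsto_const lim]; intro always_eventually allI)
    fix d
    show "0 \<le> r ^ (2 * d) * energy d h" using r energy_nonneg by simp
    show "r ^ (2 * d) * energy d h \<le> (r\<^sup>2) ^ d * (norm h)\<^sup>2"
      unfolding power_mult using r by (intro mult_left_mono energy_le) simp
  qed
qed (use r in auto)

end

section \<open>Operators commuting with the right creation operators\<close>

text \<open>
  Purity is the convergence to zero of the energies; it makes \<open>r = 1\<close> admissible in the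
  resolution of the identity.
\<close>

locale pure_row = stabilized_row G T P S + onb "free_semigroupoid G" \<xi>
  for G :: "('v, 'e) pre_digraph" and T :: "'e \<Rightarrow> ('h::chilbert_space \<Rightarrow>\<^sub>L 'h)" and P S
    and \<xi> :: "('v, 'e) fpath \<Rightarrow> 'k::chilbert_space" +
  assumes pure: "(\<lambda>d. energy d (h :: 'h)) \<longlonglongrightarrow> 0"
begin

sublocale F: frame paths \<xi> "\<Delta> 1" "\<tau> 1"
  by (intro frame.intro frame_axioms.intro onb.intro psd.intro onb \<Delta>_positive \<tau>_cbounded path_resolution)
     (use pure in auto)

lemma \<tau>_1: "\<tau> 1 w h = Tp w h"
  by (simp add: \<tau>_apply)

lemma right_creation_exists:
  assumes "v \<in> paths"
  shows "\<exists>A\<in>cbounded. \<forall>u\<in>paths. blinfun_apply A (\<xi> u) = (if fst u = rng v then \<xi> (path_concat u v) else 0)"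
proof -
  have "inj_on (\<lambda>u. path_concat u v) {u \<in> paths. fst u = rng v}"
    by (auto simp: inj_on_def path_concat_def)
  moreover have "(\<lambda>u. path_concat u v) ` {u \<in> paths. fst u = rng v} \<subseteq> paths"
    using assms by (auto intro!: path_concat_in(1))
  ultimately obtain A where "A \<in> cbounded" and
    "\<forall>u\<in>paths. A (\<xi> u) = (if u \<in> {u \<in> paths. fst u = rng v} then 1 *\<^sub>C \<xi> (path_concat u v) else 0)"
    using weighted_shift[of "\<lambda>u. path_concat u v" "{u \<in> paths. fst u = rng v}" "\<lambda>_. 1"] by auto
  then show ?thesis by (intro bexI[of _ A]) auto
qed

definition right_creation :: "('v, 'e) fpath \<Rightarrow> ('k \<Rightarrow>\<^sub>L 'k)" where
  "right_creation v = (SOME A. A \<in> cbounded \<and> (\<forall>u\<in>paths. blinfun_apply A (\<xi> u) = (if fst u = rng v then \<xi> (path_concat u v) else 0)))"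

lemma right_creation_cbounded [simp]: "v \<in> paths \<Longrightarrow> right_creation v \<in> cbounded"
  and right_creation_basis: "v \<in> paths \<Longrightarrow> u \<in> paths \<Longrightarrow> right_creation v (\<xi> u) = (if fst u = rng v then \<xi> (path_concat u v) else 0)"
  using someI_ex[OF right_creation_exists[of v, unfolded Bex_def]] unfolding right_creation_def[symmetric] by blast+

text \<open>
  The set depends only on relations that are closed in the weak operator topology, yet it is
  small enough for its elements to have Fourier coefficients: they are determined by their
  values at the vertex vectors \<open>\<xi>\<^sub>x\<close>.
\<close>

definition right_commutant :: "('k \<Rightarrow>\<^sub>L 'k) set" where
  "right_commutant = {A \<in> cbounded. \<forall>v\<in>paths. A o\<^sub>L right_creation v = right_creation v o\<^sub>L A}"

lemma right_commutant_cbounded: "A \<in> right_commutant \<Longrightarrow> A \<in> cbounded"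
  by (simp add: right_commutant_def)

lemma right_commutant_apply:
  assumes "A \<in> right_commutant" "v \<in> paths"
  shows "A (right_creation v x) = right_creation v (A x)"
proof -
  have "(A o\<^sub>L right_creation v) x = (right_creation v o\<^sub>L A) x" using assms by (simp add: right_commutant_def)
  then show ?thesis by simp
qed

text \<open>
  The vector \<open>\<xi>\<^sub>z\<close> is the image under the right creation operator of \<open>z\<close> of the vertex vector
  at the range of \<open>z\<close>.
\<close>

lemma right_commutant_basis:
  assumes A: "A \<in> right_commutant" and z: "z \<in> paths"
  shows "A (\<xi> z) = right_creation z (A (\<xi> (rng z, [])))"
proof -
  have "right_creation z (A (\<xi> (rng z, []))) = A (right_creation z (\<xi> (rng z, [])))"
    using right_commutant_apply[OF A z] by simp
  also have "right_creation z (\<xi> (rng z, [])) = \<xi> z"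
    using z by (simp add: right_creation_basis range_in_verts path_concat_def)
  finally show ?thesis by simp
qed

lemma right_commutant_algebra: "op_algebra right_commutant"
  unfolding op_algebra_def
proof (intro conjI ballI allI subsetI)
  show "0 \<in> right_commutant"
    by (auto simp: right_commutant_def intro!: blinfun_eqI simp: blinfun.zero_right)
next
  fix A B assume A: "A \<in> right_commutant" and B: "B \<in> right_commutant"
  note c = right_commutant_apply[OF A] right_commutant_apply[OF B]
  show "A + B \<in> right_commutant"
    using A B by (auto simp: right_commutant_def blinfun.add_left blinfun.add_right c intro!: blinfun_eqI)
  show "A o\<^sub>L B \<in> right_commutant"
    using A B by (auto simp: right_commutant_def c intro!: blinfun_eqI)
next
  fix a A assume A: "A \<in> right_commutant"
  note c = right_commutant_apply[OF A]
  show "scaleC_op a A \<in> right_commutant"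
    using A by (auto simp: right_commutant_def scaleC_op.rep_eq c cbounded_scaleC intro!: blinfun_eqI)
qed (rule right_commutant_cbounded)

text \<open>
  The relation \<open>A R = R A\<close> says that the matrix coefficients satisfy
  \<open>\<langle>A R x, y\<rangle> = \<langle>A x, R\<^sup>* y\<rangle>\<close>, and each such equation involves only two of the functionals
  that define the topology.
\<close>

lemma right_commutant_closed: "closedin weak_operator_topology right_commutant"
proof -
  define C where "C = {\<phi> :: 'k \<times> 'k \<Rightarrow> complex. \<forall>v\<in>paths. \<forall>x y. \<phi> (right_creation v x, y) = \<phi> (x, cadjoint (right_creation v) y)}"
  have "closed C"
  proof -
    have "C = (\<Inter>v\<in>paths. \<Inter>x. \<Inter>y. {\<phi>. \<phi> (right_creation v x, y) = \<phi> (x, cadjoint (right_creation v) y)})"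
      by (auto simp: C_def)
    moreover have "closed {\<phi> :: 'k \<times> 'k \<Rightarrow> complex. \<phi> p = \<phi> q}" for p q
      by (intro closed_Collect_eq continuous_on_product_coordinates)
    ultimately show ?thesis by (auto intro!: closed_INT)
  qed
  let ?f = "\<lambda>A (x :: 'k, y). cinner (blinfun_apply A x) y"
  have mem: "A \<in> right_commutant \<longleftrightarrow> ?f A \<in> C" if A: "A \<in> cbounded" for A
  proof -
    have "A \<in> right_commutant \<longleftrightarrow> (\<forall>v\<in>paths. \<forall>x. A (right_creation v x) = right_creation v (A x))"
    proof
      show "\<forall>v\<in>paths. \<forall>x. A (right_creation v x) = right_creation v (A x)" if "A \<in> right_commutant"
        using right_commutant_apply[OF that] by blast
      show "A \<in> right_commutant" if "\<forall>v\<in>paths. \<forall>x. A (right_creation v x) = right_creation v (A x)"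
        using A that by (auto simp: right_commutant_def intro!: blinfun_eqI)
    qed
    also have "\<dots> \<longleftrightarrow> (\<forall>v\<in>paths. \<forall>x y. cinner (A (right_creation v x)) y = cinner (right_creation v (A x)) y)"
      using cinner_ext_left by metis
    also have "\<dots> \<longleftrightarrow> ?f A \<in> C" by (simp add: C_def cinner_cadjoint)
    finally show ?thesis .
  qed
  have top: "topspace (weak_operator_topology :: ('k \<Rightarrow>\<^sub>L 'k) topology) = cbounded"
    by (simp add: weak_operator_topology_def topspace_pullback_topology)
  have "cbounded - right_commutant = ?f -` (- C) \<inter> cbounded" using mem by auto
  then have "openin weak_operator_topology (cbounded - right_commutant)"
    unfolding weak_operator_topology_def openin_pullback_topology
    using \<open>closed C\<close> by (intro exI[of _ "- C"]) (simp add: open_openin[symmetric] open_Compl)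
  then show ?thesis
    unfolding closedin_def top using right_commutant_cbounded by auto
qed

section \<open>The functional calculus\<close>

text \<open>
  With \<open>a\<^sub>u\<close> the Fourier coefficient of \<open>A\<close> at the path \<open>u\<close>, the operator
  \<open>X = \<Sum>\<^sub>u a\<^sub>u r\<^bsup>|u|\<^esup> u(T)\<close> exists for \<open>r < 1\<close>. Indeed the row of all \<open>r\<^bsup>|u|\<^esup> u(T)\<close> is
  bounded, by \<open>(1 - r\<^sup>2)\<^bsup>-1/2\<^esup>\<close>, and the coefficient column \<open>(a\<^sub>u P\<^bsub>s(u)\<^esub> y)\<close> is square
  summable, because for each vertex \<open>x\<close> the \<open>a\<^sub>u\<close> with \<open>s(u) = x\<close> are the coordinates of
  \<open>A \<xi>\<^sub>x\<close>. The bound on the norm of \<open>X\<close> that this gives blows up as \<open>r\<close> tends to \<open>1\<close>; it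
  serves only to make \<open>X\<close> a bounded operator.
\<close>

lemma scaled_calculus_exists:
  assumes r: "0 \<le> r" "r < 1" and A: "A \<in> cbounded"
  shows "\<exists>X\<in>cbounded. \<forall>y. ((\<lambda>u. cinner (A (\<xi> (fst u, []))) (\<xi> u) *\<^sub>C \<tau> r u y) has_sum blinfun_apply X y) paths"
proof -
  interpret Fr: frame paths \<xi> "\<Delta> r" "\<tau> r" by (rule frame_scaled[OF r onb])
  interpret I: psd "id_blinfun :: 'h \<Rightarrow>\<^sub>L 'h"
    by unfold_locales (auto simp: positive_op_def cinner_self complex_nonneg_Reals_iff)
  have quadI: "I.quad x = (norm x)\<^sup>2" for x by (simp add: I.quad_def I.form_def cinner_self)
  define a where "a u = cinner (A (\<xi> (fst u, []))) (\<xi> u)" for u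
  define C where "C = 1 / (1 - r\<^sup>2)"
  have r2: "r\<^sup>2 < 1" using r by (simp add: abs_square_less_1)
  then have C: "0 \<le> C" by (simp add: C_def)
  have rows: "(\<Sum>u\<in>U. (norm (cadjoint (\<tau> r u) g))\<^sup>2) \<le> C * (norm g)\<^sup>2"
    if U: "finite U" "U \<subseteq> paths" for U g
  proof -
    \<comment> \<open>\<open>\<Delta> r \<ge> 1 - r\<^sup>2\<close>, so the resolution of the identity for \<open>r T\<close> bounds the row\<close>
    have "(1 - r\<^sup>2) * (norm x)\<^sup>2 \<le> Fr.quad x" for x
      using mult_left_mono[OF row_energy_le[of x], of "r\<^sup>2"] r by (simp add: quad_\<Delta> algebra_simps)
    then have "(1 - r\<^sup>2) * (\<Sum>u\<in>U. (norm (cadjoint (\<tau> r u) g))\<^sup>2) \<le> (\<Sum>u\<in>U. Fr.quad (cadjoint (\<tau> r u) g))"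
      unfolding sum_distrib_left by (rule sum_mono)
    also have "\<dots> \<le> (norm g)\<^sup>2" by (rule Fr.finite_resolution[OF U])
    finally show ?thesis using r2 by (simp add: C_def field_simps)
  qed
  have fin: "(norm (\<Sum>u\<in>U. a u *\<^sub>C \<tau> r u y))\<^sup>2 \<le> C * (\<Sum>u\<in>U. (cmod (a u))\<^sup>2 * (norm (P (fst u) y))\<^sup>2)"
    if U: "finite U" "U \<subseteq> paths" for U y
  proof -
    have "(\<Sum>u\<in>U. a u *\<^sub>C \<tau> r u y) = (\<Sum>u\<in>U. \<tau> r u (id_blinfun (a u *\<^sub>C P (fst u) y)))"
    proof (intro sum.cong refl)
      fix u assume "u \<in> U"
      then have "u \<in> paths" using U by blast
      then show "a u *\<^sub>C \<tau> r u y = \<tau> r u (id_blinfun (a u *\<^sub>C P (fst u) y))"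
        by (simp add: cbounded_scaleC \<tau>_P source_in_verts)
    qed
    then show ?thesis
      using I.row_bound[OF U(1), of "\<tau> r" C "\<lambda>u. a u *\<^sub>C P (fst u) y"] \<tau>_cbounded[OF subsetD[OF U(2)]] C rows[OF U]
      by (simp add: quadI norm_scaleC power_mult_distrib)
  qed
  have coeff: "(\<Sum>u\<in>U. (cmod (a u))\<^sup>2 * (norm (P (fst u) y))\<^sup>2) \<le> (norm A)\<^sup>2 * (norm y)\<^sup>2"
    if U: "finite U" "U \<subseteq> paths" for U y
  proof -
    have "(\<Sum>u\<in>U. (cmod (a u))\<^sup>2 * (norm (P (fst u) y))\<^sup>2)
        = (\<Sum>x\<in>fst ` U. \<Sum>u\<in>{u \<in> U. fst u = x}. (cmod (a u))\<^sup>2 * (norm (P (fst u) y))\<^sup>2)"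
      by (rule sum.group[symmetric]) (use U in auto)
    also have "\<dots> \<le> (\<Sum>x\<in>fst ` U. (norm A)\<^sup>2 * (norm (P x y))\<^sup>2)"
    proof (rule sum_mono)
      fix x assume x: "x \<in> fst ` U"
      then have xv: "x \<in> verts G" using U source_in_verts by auto
      have "(\<Sum>u\<in>{u \<in> U. fst u = x}. (cmod (a u))\<^sup>2 * (norm (P (fst u) y))\<^sup>2)
          = (\<Sum>u\<in>{u \<in> U. fst u = x}. (cmod (cinner (A (\<xi> (x, []))) (\<xi> u)))\<^sup>2) * (norm (P x y))\<^sup>2"
        unfolding sum_distrib_right by (rule sum.cong) (auto simp: a_def)
      also have "\<dots> \<le> (norm (A (\<xi> (x, []))))\<^sup>2 * (norm (P x y))\<^sup>2"
        by (intro mult_right_mono bessel) (use U in auto)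
      also have "\<dots> \<le> (norm A)\<^sup>2 * (norm (P x y))\<^sup>2"
      proof (intro mult_right_mono power_mono)
        have "complex_of_real ((norm (\<xi> (x, [])))\<^sup>2) = 1"
          using orthonormal[of "(x, [])" "(x, [])"] xv by (simp add: cinner_self)
        then have "(norm (\<xi> (x, [])))\<^sup>2 = 1" by (simp only: of_real_eq_1_iff)
        then have "norm (\<xi> (x, [])) = 1" by (simp add: power2_eq_1_iff) (metis norm_ge_zero not_one_le_zero neg_0_le_iff_le)
        then show "norm (A (\<xi> (x, []))) \<le> norm A" using norm_blinfun[of A "\<xi> (x, [])"] by simp
      qed simp_all
      finally show "(\<Sum>u\<in>{u \<in> U. fst u = x}. (cmod (a u))\<^sup>2 * (norm (P (fst u) y))\<^sup>2)
          \<le> (norm A)\<^sup>2 * (norm (P x y))\<^sup>2" .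
    qed
    also have "\<dots> = (norm A)\<^sup>2 * (\<Sum>x\<in>fst ` U. (norm (P x y))\<^sup>2)" by (simp add: sum_distrib_left)
    also have "\<dots> \<le> (norm A)\<^sup>2 * (norm y)\<^sup>2"
      by (intro mult_left_mono finite_sum_le_has_sum[OF P_norm_sum])
         (use U source_in_verts in auto)
    finally show ?thesis .
  qed
  define X where "X y = (\<Sum>\<^sub>\<infinity>u\<in>paths. a u *\<^sub>C \<tau> r u y)" for y
  let ?b = "\<lambda>y u. (cmod (a u))\<^sup>2 * (norm (P (fst u) y))\<^sup>2"
  have b: "?b y summable_on paths" "infsum (?b y) paths \<le> (norm A)\<^sup>2 * (norm y)\<^sup>2" for y
    using nonneg_finite_sums_bounded[of paths "?b y", OF _ coeff] by auto
  have "(\<lambda>u. a u *\<^sub>C \<tau> r u y) summable_on paths" for y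
    by (rule square_dominated_summable(1)[where b = "?b y", OF fin b(1) _ C]) auto
  then have X: "((\<lambda>u. a u *\<^sub>C \<tau> r u y) has_sum X y) paths" for y
    unfolding X_def by (rule has_sum_infsum)
  have bound: "norm (X y) \<le> norm y * (sqrt C * norm A)" for y
  proof (rule power2_le_imp_le)
    have "(norm (X y))\<^sup>2 \<le> C * infsum (?b y) paths"
      unfolding X_def by (rule square_dominated_summable(2)[where b = "?b y", OF fin b(1) _ C]) auto
    also have "\<dots> \<le> C * ((norm A)\<^sup>2 * (norm y)\<^sup>2)" by (rule mult_left_mono[OF b(2) C])
    also have "\<dots> = (norm y * (sqrt C * norm A))\<^sup>2" using C by (simp add: power_mult_distrib)
    finally show "(norm (X y))\<^sup>2 \<le> (norm y * (sqrt C * norm A))\<^sup>2" .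
  qed (use C in simp)
  have XC: "X (c *\<^sub>C y) = c *\<^sub>C X y" for c y
  proof (rule has_sum_unique[OF X])
    have "((\<lambda>u. c *\<^sub>C (a u *\<^sub>C \<tau> r u y)) has_sum c *\<^sub>C X y) paths"
      by (rule has_sum_bounded_linear[OF scaleC.bounded_linear_right X])
    then show "((\<lambda>u. a u *\<^sub>C \<tau> r u (c *\<^sub>C y)) has_sum c *\<^sub>C X y) paths"
      by (rule has_sum_cong[THEN iffD1, rotated]) (simp add: cbounded_scaleC scaleC_scaleC mult.commute)
  qed
  have lin: "bounded_linear X"
  proof (rule bounded_linear_intro[OF _ _ bound])
    show "X (y + z) = X y + X z" for y z
      by (rule has_sum_unique[OF X])
         (use has_sum_add[OF X X] in \<open>simp add: blinfun.add_right scaleC_add_right\<close>)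
    show "X (t *\<^sub>R y) = t *\<^sub>R X y" for t y
      using XC[of "of_real t" y] by (simp add: scaleC_of_real)
  qed
  show ?thesis
    using X XC unfolding a_def
    by (intro bexI[of _ "Blinfun X"]) (auto simp: bounded_linear_Blinfun_apply[OF lin] cbounded_def)
qed

text \<open>
  On a vector \<open>y\<close> in the range of one vertex projection, only the paths that start at that
  vertex act, and the series \<open>\<Sum>\<^sub>u a\<^sub>u r\<^bsup>|u|\<^esup> u(T) y\<close> is the image of the Fourier expansion of
  \<open>A \<xi>\<^sub>x\<close>.
\<close>

lemma scaled_calculus_eq:
  assumes M: "clinear M" and Mu: "\<And>u. u \<in> paths \<Longrightarrow> M (\<xi> u) = \<tau> r u y"
    and x: "x \<in> verts G" "P x y = y"
    and X: "((\<lambda>u. cinner (blinfun_apply A (\<xi> (fst u, []))) (\<xi> u) *\<^sub>C \<tau> r u y) has_sum Xy) paths"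
  shows "Xy = M (A (\<xi> (x, [])))"
proof (rule has_sum_unique[OF X])
  have "((\<lambda>u. cinner (A (\<xi> (x, []))) (\<xi> u) *\<^sub>C M (\<xi> u)) has_sum M (A (\<xi> (x, [])))) paths"
    by (rule clinear_expansion[OF M])
  then show "((\<lambda>u. cinner (A (\<xi> (fst u, []))) (\<xi> u) *\<^sub>C \<tau> r u y) has_sum M (A (\<xi> (x, [])))) paths"
  proof (rule has_sum_cong[THEN iffD1, rotated])
    fix u assume u: "u \<in> paths"
    have "\<tau> r u y = 0" if "fst u \<noteq> x"
      using \<tau>_P[OF u x(1), of r y] that by (simp add: x(2))
    then show "cinner (A (\<xi> (x, []))) (\<xi> u) *\<^sub>C M (\<xi> u)
        = cinner (A (\<xi> (fst u, []))) (\<xi> u) *\<^sub>C \<tau> r u y"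
      by (cases "fst u = x") (simp_all add: Mu[OF u] scaleC.zero_right)
  qed
qed

lemma dilation_exists:
  assumes "0 \<le> r" "r \<le> 1"
  shows "\<exists>D\<in>cbounded. norm D \<le> 1 \<and> (\<forall>u\<in>paths. blinfun_apply D (\<xi> u) = of_real (r ^ length (snd u)) *\<^sub>C \<xi> u)"
  using weighted_shift[of "\<lambda>u. u" paths "\<lambda>u. of_real (r ^ length (snd u))"] assms
  by (auto simp: power_le_one norm_power)


text \<open>
  Two passages through the scaled calculus \<open>X\<^sub>r\<close>. First, \<open>X\<^sub>r\<close> intertwines the maps \<open>\<theta>\<close> of the
  row contraction \<open>r T\<close> with \<open>A\<close>, whence \<open>\<parallel>X\<^sub>r\<parallel> \<le> \<parallel>A\<parallel>\<close> independently of \<open>r\<close>. Second, on the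
  generators \<open>z(T) \<Delta> k\<close> of the unscaled frame, \<open>X\<^sub>r\<close> acts as \<open>\<theta>\<^sub>k R\<^sub>z D\<^sub>r A \<xi>\<^bsub>r(z)\<^esub>\<close> with
  \<open>D\<^sub>r \<xi>\<^sub>w = r\<^bsup>|w|\<^esup> \<xi>\<^sub>w\<close>, and this tends to \<open>\<theta>\<^sub>k A \<xi>\<^sub>z\<close> as \<open>r\<close> tends to \<open>1\<close>. So the \<open>X\<^sub>r\<close>
  converge strongly, and the limit intertwines.
\<close>

lemma calculus_exists:
  assumes A: "A \<in> right_commutant"
  shows "\<exists>X\<in>cbounded. norm X \<le> norm A \<and> (\<forall>k f. blinfun_apply X (F.\<theta> k f) = F.\<theta> k (A f))"
proof -
  have Ac: "A \<in> cbounded" using A by (rule right_commutant_cbounded)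
  \<comment> \<open>any sequence in \<open>[0, 1)\<close> with limit \<open>1\<close> would do\<close>
  define r where "r n = 1 - 1 / real (n + 2)" for n
  have r: "0 \<le> r n" "r n < 1" "r n \<le> 1" for n by (auto simp: r_def field_simps)
  have r_lim: "r \<longlonglongrightarrow> 1"
    unfolding fun_eq_iff[THEN iffD2, of r, OF allI, OF r_def]
    using tendsto_diff[OF tendsto_const LIMSEQ_ignore_initial_segment[OF lim_1_over_n[where 'a = real], of 2], of 1]
    by simp
  have "\<forall>n. \<exists>X. X \<in> cbounded \<and>
      (\<forall>y. ((\<lambda>u. cinner (A (\<xi> (fst u, []))) (\<xi> u) *\<^sub>C \<tau> (r n) u y) has_sum blinfun_apply X y) paths)"
    using scaled_calculus_exists[OF r(1,2) Ac] by blast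
  from choice[OF this] obtain X where Xc: "\<And>n. X n \<in> cbounded"
    and X: "\<And>n y. ((\<lambda>u. cinner (A (\<xi> (fst u, []))) (\<xi> u) *\<^sub>C \<tau> (r n) u y) has_sum blinfun_apply (X n) y) paths"
    by blast
  have "\<forall>n. \<exists>D. D \<in> cbounded \<and> norm D \<le> 1 \<and>
      (\<forall>u\<in>paths. blinfun_apply D (\<xi> u) = of_real (r n ^ length (snd u)) *\<^sub>C \<xi> u)"
    using dilation_exists[OF r(1,3)] by blast
  from choice[OF this] obtain D where Dc: "\<And>n. D n \<in> cbounded" and Dn: "\<And>n. norm (D n) \<le> 1"
    and D: "\<And>n u. u \<in> paths \<Longrightarrow> blinfun_apply (D n) (\<xi> u) = of_real (r n ^ length (snd u)) *\<^sub>C \<xi> u"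
    by blast
  have range_\<tau>: "P (rng z) (\<tau> t z y) = \<tau> t z y" if "z \<in> paths" for z t y
    using that by (simp add: \<tau>_apply blinfun.scaleR_right P_Tp range_in_verts)
  have Xnorm: "norm (X n) \<le> norm A" for n
  proof -
    have fr: "frame paths \<xi> (\<Delta> (r n)) (\<tau> (r n))" by (rule frame_scaled[OF r(1,2) onb])
    interpret Fr: frame paths \<xi> "\<Delta> (r n)" "\<tau> (r n)" by (rule fr)
    show ?thesis
    proof (rule Fr.intertwined_norm_le[OF Xc Ac])
      fix k z assume z: "z \<in> paths"
      have "X n (\<tau> (r n) z (\<Delta> (r n) k)) = Fr.\<theta> k (right_creation z (A (\<xi> (rng z, []))))"
      proof (rule scaled_calculus_eq[where M = "\<lambda>f. Fr.\<theta> k (right_creation z f)" and r = "r n" and A = A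
            and y = "\<tau> (r n) z (\<Delta> (r n) k)" and x = "rng z"])
        show "rng z \<in> verts G" by (rule range_in_verts[OF z])
        show "P (rng z) (\<tau> (r n) z (\<Delta> (r n) k)) = \<tau> (r n) z (\<Delta> (r n) k)" by (rule range_\<tau>[OF z])
        show "((\<lambda>u. cinner (A (\<xi> (fst u, []))) (\<xi> u) *\<^sub>C \<tau> (r n) u (\<tau> (r n) z (\<Delta> (r n) k)))
            has_sum X n (\<tau> (r n) z (\<Delta> (r n) k))) paths" by (rule X)
        show "clinear (\<lambda>f. Fr.\<theta> k (right_creation z f))"
          by (rule clinear_compose[OF Fr.\<theta>_clinear clinear_cbounded[OF right_creation_cbounded[OF z]]])
        fix u assume u: "u \<in> paths"
        show "Fr.\<theta> k (right_creation z (\<xi> u)) = \<tau> (r n) u (\<tau> (r n) z (\<Delta> (r n) k))"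
          using clinear_0[OF Fr.\<theta>_clinear] path_concat_in[OF u z]
          by (auto simp: right_creation_basis[OF z u] \<tau>_\<tau>[OF u z] Fr.\<theta>_basis)
      qed
      then show "X n (Fr.\<theta> k (\<xi> z)) = Fr.\<theta> k (A (\<xi> z))"
        by (simp add: Fr.\<theta>_basis[OF z] right_commutant_basis[OF A z])
    qed
  qed
  have D_lim: "(\<lambda>n. D n f) \<longlonglongrightarrow> f" for f
  proof -
    have basis: "(\<lambda>n. D n (c *\<^sub>C \<xi> u)) \<longlonglongrightarrow> c *\<^sub>C \<xi> u" if u: "u \<in> paths" for c u
    proof -
      have "(\<lambda>n. c *\<^sub>C (complex_of_real (r n ^ length (snd u)) *\<^sub>C \<xi> u))
          \<longlonglongrightarrow> c *\<^sub>C (complex_of_real (1 ^ length (snd u)) *\<^sub>C \<xi> u)"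
        by (intro scaleC.tendsto tendsto_intros r_lim)
      then show ?thesis by (simp add: cbounded_scaleC[OF Dc] D[OF u])
    qed
    have "\<exists>Y. norm Y \<le> 1 \<and> (\<forall>x. (\<lambda>n. D n x) \<longlonglongrightarrow> blinfun_apply Y x)"
      by (rule strong_limit_exists[OF Dn basis_dense]) (use basis in \<open>auto intro: convergentI\<close>)
    then obtain Y where Y: "\<And>x. (\<lambda>n. D n x) \<longlonglongrightarrow> blinfun_apply Y x" by blast
    have YC: "Y \<in> cbounded"
      unfolding cbounded_def mem_Collect_eq
    proof (intro allI)
      fix c x
      have "(\<lambda>n. D n (c *\<^sub>C x)) \<longlonglongrightarrow> c *\<^sub>C Y x"
        unfolding cbounded_scaleC[OF Dc] by (intro scaleC.tendsto tendsto_const Y)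
      then show "Y (c *\<^sub>C x) = c *\<^sub>C Y x" by (rule LIMSEQ_unique[OF Y])
    qed
    have "Y f = id_blinfun f"
    proof (rule clinear_eqI[where M = "blinfun_apply Y" and N = "blinfun_apply id_blinfun"])
      fix u assume "u \<in> paths"
      then show "Y (\<xi> u) = id_blinfun (\<xi> u)"
        using LIMSEQ_unique[OF Y basis[of u 1]] by simp
    qed (rule clinear_cbounded, simp add: YC)+
    with Y[of f] show ?thesis by simp
  qed
  have X_lim: "(\<lambda>n. X n (\<tau> 1 z (\<Delta> 1 k))) \<longlonglongrightarrow> F.\<theta> k (A (\<xi> z))" if z: "z \<in> paths" for z k
  proof -
    have "X n (\<tau> 1 z (\<Delta> 1 k)) = F.\<theta> k (right_creation z (D n (A (\<xi> (rng z, [])))))" for n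
    proof (rule scaled_calculus_eq[where M = "\<lambda>f. F.\<theta> k (right_creation z (D n f))" and r = "r n" and A = A
          and y = "\<tau> 1 z (\<Delta> 1 k)" and x = "rng z"])
      show "rng z \<in> verts G" by (rule range_in_verts[OF z])
      show "P (rng z) (\<tau> 1 z (\<Delta> 1 k)) = \<tau> 1 z (\<Delta> 1 k)" by (rule range_\<tau>[OF z])
      show "((\<lambda>u. cinner (A (\<xi> (fst u, []))) (\<xi> u) *\<^sub>C \<tau> (r n) u (\<tau> 1 z (\<Delta> 1 k)))
          has_sum X n (\<tau> 1 z (\<Delta> 1 k))) paths" by (rule X)
      show "clinear (\<lambda>f. F.\<theta> k (right_creation z (D n f)))"
        by (rule clinear_compose[OF F.\<theta>_clinear
              clinear_compose[OF clinear_cbounded[OF right_creation_cbounded[OF z]] clinear_cbounded[OF Dc]]])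
      fix u assume u: "u \<in> paths"
      have \<theta>: "F.\<theta> k (t *\<^sub>R f) = t *\<^sub>R F.\<theta> k f" "F.\<theta> k 0 = 0" for t f
        using F.\<theta>_clinear[of k] by (auto simp: clinear_def bounded_linear.linear linear_0 linear_cmul)
      show "F.\<theta> k (right_creation z (D n (\<xi> u))) = \<tau> (r n) u (\<tau> 1 z (\<Delta> 1 k))"
        using path_concat_in[OF u z] Tp_Tp[OF u z]
        by (auto simp: D[OF u] right_creation_basis[OF z u] \<theta> F.\<theta>_basis \<tau>_apply scaleC_of_real
            blinfun.scaleR_right simp del: of_real_power)
    qed
    moreover have "(\<lambda>n. F.\<theta> k (right_creation z (D n (A (\<xi> (rng z, [])))))) \<longlonglongrightarrow> F.\<theta> k (right_creation z (A (\<xi> (rng z, []))))"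
      using F.\<theta>_clinear[of k] unfolding clinear_def
      by (intro bounded_linear.tendsto[of "F.\<theta> k"] blinfun.tendsto tendsto_const D_lim) blast
    ultimately show ?thesis by (simp add: right_commutant_basis[OF A z])
  qed
  have "\<exists>Y. norm Y \<le> norm A \<and> (\<forall>x. (\<lambda>n. X n x) \<longlonglongrightarrow> blinfun_apply Y x)"
    by (rule strong_limit_exists[OF Xnorm F.generators_dense]) (use X_lim in \<open>auto intro: convergentI\<close>)
  then obtain Y where Yn: "norm Y \<le> norm A" and Y: "\<And>x. (\<lambda>n. X n x) \<longlonglongrightarrow> blinfun_apply Y x" by blast
  have YC: "Y \<in> cbounded"
    unfolding cbounded_def mem_Collect_eq
  proof (intro allI)
    fix c x
    have "(\<lambda>n. X n (c *\<^sub>C x)) \<longlonglongrightarrow> c *\<^sub>C Y x"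
      unfolding cbounded_scaleC[OF Xc] by (intro scaleC.tendsto tendsto_const Y)
    then show "Y (c *\<^sub>C x) = c *\<^sub>C Y x" by (rule LIMSEQ_unique[OF Y])
  qed
  have "Y (F.\<theta> k (\<xi> z)) = F.\<theta> k (A (\<xi> z))" if z: "z \<in> paths" for k z
    unfolding F.\<theta>_basis[OF z] by (rule LIMSEQ_unique[OF Y X_lim[OF z]])
  then have "Y (F.\<theta> k f) = F.\<theta> k (A f)" for k f
    by (rule F.intertwined_on_basis[OF YC Ac])
  with YC Yn show ?thesis by blast
qed

lemma calculus_unique:
  fixes X Y :: "'h \<Rightarrow>\<^sub>L 'h"
  assumes "\<And>k f. blinfun_apply X (F.\<theta> k f) = blinfun_apply Y (F.\<theta> k f)"
  shows "X = Y"
  by (rule F.eq_on_generators) (metis assms F.\<theta>_basis)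

definition calculus :: "('k \<Rightarrow>\<^sub>L 'k) \<Rightarrow> ('h \<Rightarrow>\<^sub>L 'h)" where
  "calculus A = (SOME X. X \<in> cbounded \<and> norm X \<le> norm A \<and> (\<forall>k f. blinfun_apply X (F.\<theta> k f) = F.\<theta> k (A f)))"

lemma
  assumes "A \<in> right_commutant"
  shows calculus_cbounded: "calculus A \<in> cbounded" and calculus_norm: "norm (calculus A) \<le> norm A"
    and calculus_\<theta>: "calculus A (F.\<theta> k f) = F.\<theta> k (A f)"
  using someI_ex[OF calculus_exists[OF assms, unfolded Bex_def]] unfolding calculus_def[symmetric] by blast+

lemma calculus_eqI:
  assumes "A \<in> right_commutant" and X: "X \<in> cbounded"
    and basis: "\<And>k z. z \<in> paths \<Longrightarrow> blinfun_apply X (F.\<theta> k (\<xi> z)) = F.\<theta> k (A (\<xi> z))"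
  shows "calculus A = X"
proof (rule calculus_unique)
  fix k f
  have "blinfun_apply X (F.\<theta> k f) = F.\<theta> k (A f)"
    by (rule F.intertwined_on_basis[OF X right_commutant_cbounded[OF assms(1)] basis])
  then show "calculus A (F.\<theta> k f) = X (F.\<theta> k f)" by (simp add: calculus_\<theta>[OF assms(1)])
qed

text \<open>
  The relation \<open>calculus A \<circ> \<theta>\<^sub>k = \<theta>\<^sub>k \<circ> A\<close> determines the calculus and is compatible with
  sums, products and scalar multiples of \<open>A\<close>.
\<close>

lemma calculus_homomorphism: "contractive_homomorphism right_commutant calculus"
proof -
  have \<theta>: "F.\<theta> k (c *\<^sub>C f) = c *\<^sub>C F.\<theta> k f" "F.\<theta> k (f + g) = F.\<theta> k f + F.\<theta> k g" for k c f g
    using F.\<theta>_clinear[of k] by (auto simp: clinear_def linear_add bounded_linear.linear)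
  have alg: "A + B \<in> right_commutant" "A o\<^sub>L B \<in> right_commutant"
    if "A \<in> right_commutant" "B \<in> right_commutant" for A B
    using right_commutant_algebra that unfolding op_algebra_def by blast+
  have alg_scale: "scaleC_op c A \<in> right_commutant" if "A \<in> right_commutant" for A c
    using right_commutant_algebra that unfolding op_algebra_def by blast
  show ?thesis
    unfolding contractive_homomorphism_def
  proof (intro conjI ballI allI)
    fix A assume A: "A \<in> right_commutant"
    show "calculus A \<in> cbounded" "norm (calculus A) \<le> norm A" using A by (rule calculus_cbounded, rule calculus_norm)
    show "calculus (scaleC_op c A) = scaleC_op c (calculus A)" for c
      by (rule calculus_unique) (simp add: calculus_\<theta> alg_scale A scaleC_op.rep_eq \<theta>)
    fix B assume B: "B \<in> right_commutant"
    show "calculus (A + B) = calculus A + calculus B"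
      by (rule calculus_unique) (simp add: calculus_\<theta> alg A B blinfun.add_left \<theta>)
    show "calculus (A o\<^sub>L B) = calculus A o\<^sub>L calculus B"
      by (rule calculus_unique) (simp add: calculus_\<theta> alg A B)
  qed
qed

section \<open>Values on the generators\<close>

lemma right_commutantI:
  assumes A: "A \<in> cbounded"
    and basis: "\<And>u v. u \<in> paths \<Longrightarrow> v \<in> paths \<Longrightarrow> A (right_creation v (\<xi> u)) = right_creation v (A (\<xi> u))"
  shows "A \<in> right_commutant"
proof -
  have "A o\<^sub>L right_creation v = right_creation v o\<^sub>L A" if v: "v \<in> paths" for v
  proof (rule blinfun_eqI)
    fix f
    show "(A o\<^sub>L right_creation v) f = (right_creation v o\<^sub>L A) f"
      by (rule clinear_eqI[where M = "blinfun_apply (A o\<^sub>L right_creation v)" and N = "blinfun_apply (right_creation v o\<^sub>L A)"])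
         (use A v basis in \<open>auto intro: clinear_cbounded\<close>)
  qed
  with A show ?thesis by (simp add: right_commutant_def)
qed

lemma creation_op_spec:
  assumes e: "e \<in> arcs G"
  shows "creation_op G \<xi> e \<in> cbounded"
    and "w \<in> paths \<Longrightarrow> creation_op G \<xi> e (\<xi> w) = (if rng w = tail G e then \<xi> (extend_path e w) else 0)"
proof -
  let ?Q = "\<lambda>A. A \<in> cbounded \<and> (\<forall>w\<in>paths. blinfun_apply A (\<xi> w) = (if rng w = tail G e then \<xi> (extend_path e w) else 0))"
  have "inj_on (extend_path e) {w \<in> paths. rng w = tail G e}"
    by (auto simp: inj_on_def extend_path_def)
  moreover have "extend_path e ` {w \<in> paths. rng w = tail G e} \<subseteq> paths"
    using e by (auto intro!: extend_path_in(1))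
  ultimately obtain A where "A \<in> cbounded" and
    "\<forall>u\<in>paths. A (\<xi> u) = (if u \<in> {w \<in> paths. rng w = tail G e} then 1 *\<^sub>C \<xi> (extend_path e u) else 0)"
    using weighted_shift[of "extend_path e" "{w \<in> paths. rng w = tail G e}" "\<lambda>_. 1"] by auto
  then have A: "?Q A" by auto
  have "B = A" if B: "?Q B" for B
  proof (rule blinfun_eqI)
    show "blinfun_apply B f = A f" for f
      by (rule clinear_eqI[where M = "blinfun_apply B" and N = "blinfun_apply A"])
         (use A B in \<open>auto intro: clinear_cbounded\<close>)
  qed
  then have "?Q (creation_op G \<xi> e)" unfolding creation_op_def using A by (rule theI[of ?Q, rotated])
  then show "creation_op G \<xi> e \<in> cbounded"
    "w \<in> paths \<Longrightarrow> creation_op G \<xi> e (\<xi> w) = (if rng w = tail G e then \<xi> (extend_path e w) else 0)"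
    by blast+
qed

lemma creation_op_right_commutant:
  assumes e: "e \<in> arcs G"
  shows "creation_op G \<xi> e \<in> right_commutant"
proof (rule right_commutantI[OF creation_op_spec(1)[OF e]])
  fix u v assume u: "u \<in> paths" and v: "v \<in> paths"
  have "fst (extend_path e u) = fst u" "extend_path e (path_concat u v) = path_concat (extend_path e u) v"
    by (simp_all add: extend_path_def path_concat_def)
  then show "creation_op G \<xi> e (right_creation v (\<xi> u)) = right_creation v (creation_op G \<xi> e (\<xi> u))"
    using path_concat_in[OF u v] extend_path_in[OF u e] u v
    by (simp add: right_creation_basis creation_op_spec(2)[OF e] blinfun.zero_right)
qed

lemma calculus_creation_op:
  assumes e: "e \<in> arcs G"
  shows "calculus (creation_op G \<xi> e) = T e"
proof (rule calculus_eqI[OF creation_op_right_commutant[OF e] T_cbounded[OF e]])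
  fix k z assume z: "z \<in> paths"
  show "T e (F.\<theta> k (\<xi> z)) = F.\<theta> k (creation_op G \<xi> e (\<xi> z))"
    using extend_path_in[OF z e] clinear_0[OF F.\<theta>_clinear]
    by (simp add: F.\<theta>_basis z \<tau>_1 T_Tp e creation_op_spec(2)[OF e z])
qed

text \<open>
  The diagonal operator that keeps exactly the basis vectors with range \<open>x\<close> is a projection
  onto the required subspace, and such a projection is unique.
\<close>

lemma vertex_projection_spec:
  shows "vertex_projection G \<xi> x \<in> cbounded"
    and "w \<in> paths \<Longrightarrow> vertex_projection G \<xi> x (\<xi> w) = (if rng w = x then \<xi> w else 0)"
proof -
  define J where "J = {w \<in> paths. rng w = x}"
  have "J \<subseteq> paths" by (auto simp: J_def)
  then obtain A where Ac: "A \<in> cbounded" and A': "\<forall>u\<in>paths. A (\<xi> u) = (if u \<in> J then 1 *\<^sub>C \<xi> u else 0)"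
    using weighted_shift[of "\<lambda>w. w" J "\<lambda>_. 1"] by auto
  have A: "A (\<xi> u) = (if u \<in> J then \<xi> u else 0)" if "u \<in> paths" for u using A' that by simp
  have idem: "A o\<^sub>L A = A"
  proof (rule blinfun_eqI)
    show "(A o\<^sub>L A) f = A f" for f
      by (rule clinear_eqI[where M = "blinfun_apply (A o\<^sub>L A)" and N = "blinfun_apply A"])
         (use A Ac in \<open>auto intro: clinear_cbounded simp: blinfun.zero_right\<close>)
  qed
  then have AA: "A (A f) = A f" for f by (metis blinfun_apply_blinfun_compose)
  have "cadjoint A = A"
  proof (rule blinfun_eqI)
    have "cadjoint A (\<xi> j) = A (\<xi> j)" if j: "j \<in> paths" for j
    proof -
      have "cinner (\<xi> i) (cadjoint A (\<xi> j) - A (\<xi> j)) = 0" if i: "i \<in> paths" for i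
        unfolding cinner.diff_right cinner_cadjoint[OF Ac, symmetric] A[OF i] A[OF j]
        using i j by (simp add: orthonormal cinner.zero_left cinner.zero_right)
      then have "cadjoint A (\<xi> j) - A (\<xi> j) = 0" by (rule orthogonal_to_basis)
      then show ?thesis by simp
    qed
    then show "cadjoint A f = A f" for f
      by (rule clinear_eqI[where M = "blinfun_apply (cadjoint A)" and N = "blinfun_apply A",
            OF clinear_cbounded[OF cadjoint_cbounded[OF Ac]] clinear_cbounded[OF Ac]])
  qed
  with idem Ac have proj: "is_projection A" by (simp add: is_projection_def)
  have range_A: "range (blinfun_apply A) = closure (cspan (\<xi> ` J))"
  proof
    show "range (blinfun_apply A) \<subseteq> closure (cspan (\<xi> ` J))"
    proof (rule image_subsetI, rule Lim_in_closed_set)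
      fix f
      show "(sum (\<lambda>i. cinner f (\<xi> i) *\<^sub>C A (\<xi> i)) \<longlongrightarrow> A f) (finite_subsets_at_top paths)"
        using clinear_expansion[OF clinear_cbounded[OF Ac]] by (simp add: has_sum_def)
      have "cinner f (\<xi> i) *\<^sub>C A (\<xi> i) \<in> cspan (\<xi> ` J)" if "i \<in> paths" for i
        using that by (cases "i \<in> J") (simp_all add: A scaleC.zero_right complex_vector.span_zero
            complex_vector.span_scale complex_vector.span_base)
      then show "eventually (\<lambda>F. (\<Sum>i\<in>F. cinner f (\<xi> i) *\<^sub>C A (\<xi> i)) \<in> closure (cspan (\<xi> ` J)))
          (finite_subsets_at_top paths)"
        by (intro eventually_finite_subsets_at_top_weakI closure_subset[THEN subsetD]
            complex_vector.span_sum) auto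
    qed auto
    have fixed: "range (blinfun_apply A) = {f. A f = f}" using AA by (auto intro: rangeI[of A] ) (metis rangeI)
    have "complex_vector.subspace {f. A f = f}"
      unfolding complex_vector.subspace_def
      by (simp add: blinfun.zero_right blinfun.add_right cbounded_scaleC[OF Ac])
    moreover have "\<xi> ` J \<subseteq> {f. A f = f}" using \<open>J \<subseteq> paths\<close> by (auto simp: A subset_iff)
    ultimately have "cspan (\<xi> ` J) \<subseteq> {f. A f = f}" by (intro complex_vector.span_minimal)
    moreover have "closed {f. A f = f}"
      by (intro closed_Collect_eq continuous_intros)
    ultimately show "closure (cspan (\<xi> ` J)) \<subseteq> range (blinfun_apply A)"
      unfolding fixed by (rule closure_minimal)
  qed
  have "vertex_projection G \<xi> x = A"
    unfolding vertex_projection_def projection_onto_def J_def[symmetric]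
  proof (rule the_equality)
    fix Q assume "is_projection Q \<and> range (blinfun_apply Q) = closure (cspan (\<xi> ` J))"
    with proj range_A show "Q = A" by (intro projection_unique) simp_all
  qed (use proj range_A in simp)
  then show "vertex_projection G \<xi> x \<in> cbounded"
    "w \<in> paths \<Longrightarrow> vertex_projection G \<xi> x (\<xi> w) = (if rng w = x then \<xi> w else 0)"
    using Ac A by (auto simp: J_def)
qed

lemma vertex_projection_right_commutant: "vertex_projection G \<xi> x \<in> right_commutant"
proof (rule right_commutantI[OF vertex_projection_spec(1)])
  fix u v assume u: "u \<in> paths" and v: "v \<in> paths"
  show "vertex_projection G \<xi> x (right_creation v (\<xi> u)) = right_creation v (vertex_projection G \<xi> x (\<xi> u))"
    using path_concat_in[OF u v] u v
    by (simp add: right_creation_basis vertex_projection_spec(2) blinfun.zero_right)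
qed

lemma calculus_vertex_projection:
  assumes x: "x \<in> verts G"
  shows "calculus (vertex_projection G \<xi> x) = P x"
proof (rule calculus_eqI[OF vertex_projection_right_commutant P_cbounded[OF x]])
  fix k z assume z: "z \<in> paths"
  show "P x (F.\<theta> k (\<xi> z)) = F.\<theta> k (vertex_projection G \<xi> x (\<xi> z))"
    using clinear_0[OF F.\<theta>_clinear]
    by (auto simp: F.\<theta>_basis z \<tau>_1 P_Tp x vertex_projection_spec(2)[OF z])
qed

lemma algebra_subset_right_commutant: "free_semigroupoid_algebra G \<xi> \<subseteq> right_commutant"
  unfolding free_semigroupoid_algebra_def wot_algebra_generated_def
  by (rule hull_minimal)
     (auto simp: creation_op_right_commutant vertex_projection_right_commutant
       right_commutant_algebra right_commutant_closed)

end

section \<open>The representation of the free semigroupoid algebra\<close>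

text \<open>
  A sum of squares is at most the square of the sum. The two are compared at positive lengths
  at which the sum of norms is finite, which is the case from some length on.
\<close>

lemma (in stabilized_row) energy_tendsto_0:
  assumes "(\<lambda>d. \<Sum>\<^sub>\<infinity>w\<in>paths_of_length G d. ennreal (norm (cadjoint (path_op T w) h))) \<longlonglongrightarrow> 0"
  shows "(\<lambda>d. energy d h) \<longlonglongrightarrow> 0"
proof -
  define m where "m d = (\<Sum>\<^sub>\<infinity>w\<in>paths_of_length G d. ennreal (norm (cadjoint (path_op T w) h)))" for d
  have m0: "m \<longlonglongrightarrow> 0" using assms unfolding m_def .
  have bound: "energy d h \<le> (enn2real (m d))\<^sup>2" if d: "d > 0" and fin: "m d < top" for d
  proof (rule has_sum_le_finite_sums[OF energy_has_sum])
    fix F assume F: "finite F" "F \<subseteq> paths_of_length G d"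
    let ?n = "\<lambda>w. norm (cadjoint (Tp w) h)"
    have eq: "Tp w = path_op T w" if "w \<in> F" for w
      using that F d by (intro Tp_eq_path_op) (auto simp: paths_of_length_def)
    have "ennreal (\<Sum>w\<in>F. ?n w) = (\<Sum>w\<in>F. ennreal (norm (cadjoint (path_op T w) h)))"
      by (simp add: eq)
    also have "\<dots> \<le> m d"
      unfolding m_def by (subst nonneg_infsum_complete) (use F in \<open>auto intro!: SUP_upper\<close>)
    finally have le: "(\<Sum>w\<in>F. ?n w) \<le> enn2real (m d)"
      using fin enn2real_mono[of "ennreal (\<Sum>w\<in>F. ?n w)" "m d"] by (simp add: sum_nonneg)
    have "(\<Sum>w\<in>F. (?n w)\<^sup>2) \<le> (\<Sum>w\<in>F. ?n w * (\<Sum>v\<in>F. ?n v))"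
      unfolding power2_eq_square
      by (intro sum_mono mult_left_mono member_le_sum) (use F in auto)
    also have "\<dots> = (\<Sum>w\<in>F. ?n w)\<^sup>2" by (simp add: power2_eq_square sum_distrib_right)
    also have "\<dots> \<le> (enn2real (m d))\<^sup>2" by (intro power_mono le sum_nonneg) simp
    finally show "(\<Sum>w\<in>F. (?n w)\<^sup>2) \<le> (enn2real (m d))\<^sup>2" .
  qed
  have "eventually (\<lambda>d. m d < top) sequentially"
    using order_tendstoD(2)[OF m0] by simp
  then have ev: "eventually (\<lambda>d. energy d h \<le> (enn2real (m d))\<^sup>2) sequentially"
    using eventually_gt_at_top[of 0] by eventually_elim (rule bound)
  have "(\<lambda>d. enn2real (m d)) \<longlonglongrightarrow> 0" by (rule tendsto_enn2real) (use m0 in simp_all)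
  from tendsto_power[OF this, of 2] have lim: "(\<lambda>d. (enn2real (m d))\<^sup>2) \<longlonglongrightarrow> 0" by simp
  show ?thesis
    by (rule tendsto_sandwich[OF _ ev tendsto_const lim]) (simp add: energy_nonneg)
qed

theorem theorem6p2:
  fixes G :: "('v, 'e) pre_digraph"
    and T :: "'e \<Rightarrow> ('h::chilbert_space \<Rightarrow>\<^sub>L 'h)"
    and P' :: "'v \<Rightarrow> ('h \<Rightarrow>\<^sub>L 'h)"
    and \<xi> :: "('v, 'e) fpath \<Rightarrow> 'k::chilbert_space"
  assumes "wf_digraph G" and "countable (verts G)" and "countable (arcs G)"
    and "no_sinks G"
    and "row_contraction (arcs G) T"
    and "stabilized_by G T P'"
    and "\<And>h. (\<lambda>d. \<Sum>\<^sub>\<infinity>w\<in>paths_of_length G d. ennreal (norm (cadjoint (path_op T w) h)))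
               \<longlonglongrightarrow> 0"
    and "orthonormal_basis_on (free_semigroupoid G) \<xi>"
  shows "\<exists>\<Psi>. contractive_homomorphism (free_semigroupoid_algebra G \<xi>) \<Psi> \<and>
           (\<forall>e\<in>arcs G. \<Psi> (creation_op G \<xi> e) = T e) \<and>
           (\<forall>x\<in>verts G. \<Psi> (vertex_projection G \<xi> x) = P' x)"
proof -
  obtain S where S: "S \<in> cbounded" "\<And>h. ((\<lambda>e. (T e o\<^sub>L cadjoint (T e)) h) has_sum blinfun_apply S h) (arcs G)"
    "op_le S id_blinfun"
    using assms(5) unfolding row_contraction_def by blast
  interpret wf_digraph G by fact
  interpret stabilized_row G T P' S
    by unfold_locales (use assms(5,6) S in \<open>auto simp: row_contraction_def\<close>)
  interpret pure_row G T P' S \<xi>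
    by unfold_locales (rule assms(8), rule energy_tendsto_0[OF assms(7)])
  have "contractive_homomorphism (free_semigroupoid_algebra G \<xi>) calculus"
    using calculus_homomorphism algebra_subset_right_commutant
    unfolding contractive_homomorphism_def by blast
  then show ?thesis using calculus_creation_op calculus_vertex_projection by blast
qed

end
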